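(* Let $\Gamma=(V,E,\ell)$ be a finite labeled simplicial graph with all labels even, $\mathbb{K}$ a field, and $\chi:A_\Gamma\to\mathbb{Z}$ a nonzero homomorphism with Artin kernel $A^\chi_\Gamma=\ker\chi$. Then the rank of the free part of the $\mathbb{K}[t^{\pm1}]$-module $H_1(A^\chi_\Gamma;\mathbb{K})$ equals $\dim_{\mathbb{K}}\tilde H_0(\Gamma_1;\mathbb{K})$. In particular, $H_1(A^\chi_\Gamma;\mathbb{K})$ is a torsion module if and only if $\Gamma_1$ is connected.
   Context: $\Gamma=(V,E,\ell)$: finite simplicial graph, labels $\ell(e)=2\tilde\ell(e)$, $\tilde\ell(e)\ge1$; $A_\Gamma=\langle g_v\ (v\in V)\mid (g_vg_w)^{\tilde\ell(e)}=(g_wg_v)^{\tilde\ell(e)},\ e=\{v,w\}\in E\rangle$. Write $m_v=\chi(g_v)$ and $m_e=m_v+m_w$ for $e=\{v,w\}\in E$. $H_1(A^\chi_\Gamma;\mathbb{K})$ is a $\mathbb{K}[t^{\pm1}]$-module, $t$ acting via the automorphism induced by conjugation by an element $g\in A_\Gamma$ such that $\chi(g)$ generates $\operatorname{im}\chi$. The resonance sets are $V_{\mathcal R}=\{v\in V: m_v=0\}$ and $E_{\mathcal R}=\{e\in E: m_e=0\text{ and }\tilde\ell(e)\cdot1_{\mathbb{K}}=0\}$. The graph $\Gamma_1$ is obtained from $\Gamma$ by deleting the (open) edges $e=\{v,w\}\in E$ for which either $v,w\in V_{\mathcal R}$ or $e\in E_{\mathcal R}$, and deleting (with their incident edges) the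 vertices $v\in V_{\mathcal R}$ that are adjacent in $\Gamma$ to some vertex of $V\setminus V_{\mathcal R}$. $\tilde H_0(\Gamma_1;\mathbb{K})$ is reduced $0$-th homology of $\Gamma_1$ viewed as a $1$-dimensional complex. *)

theory Defs
  imports Main
begin

text \<open>A letter (v, True) is g_v, a letter (v, False) is g_v^{-1}.\<close>
type_synonym 'v word = "('v \<times> bool) list"

definition words :: "'v set \<Rightarrow> 'v word set" where
  "words V = {w. fst ` set w \<subseteq> V}"

definition winv :: "'v word \<Rightarrow> 'v word" where
  "winv w = rev (map (\<lambda>(v, b). (v, \<not> b)) w)"

definition wpow :: "'v word \<Rightarrow> nat \<Rightarrow> 'v word" where
  "wpow w n = concat (replicate n w)"

definition wzpow :: "'v word \<Rightarrow> int \<Rightarrow> 'v word" where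
  "wzpow w k = (if 0 \<le> k then wpow w (nat k) else wpow (winv w) (nat (- k)))"

text \<open>E is a set of 2-element subsets of V; lt e is \<open>\<tilde>\<ell>(e)\<close>, so the label is 2 * lt e.
  artin_eq is the equivalence relation on words over V identifying words that
  represent the same element of
  A_Gamma = < g_v | (g_v g_w)^(lt e) = (g_w g_v)^(lt e), e = {v,w} in E >.\<close>
inductive artin_eq :: "'v set \<Rightarrow> 'v set set \<Rightarrow> ('v set \<Rightarrow> nat) \<Rightarrow> 'v word \<Rightarrow> 'v word \<Rightarrow> bool"
  for V E lt where
  a_refl: "w \<in> words V \<Longrightarrow> artin_eq V E lt w w"
| a_sym: "artin_eq V E lt u w \<Longrightarrow> artin_eq V E lt w u"
| a_trans: "artin_eq V E lt u w \<Longrightarrow> artin_eq V E lt w x \<Longrightarrow> artin_eq V E lt u x"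
| a_cancel: "u \<in> words V \<Longrightarrow> w \<in> words V \<Longrightarrow> v \<in> V \<Longrightarrow>
     artin_eq V E lt (u @ [(v, b), (v, \<not> b)] @ w) (u @ w)"
| a_rel: "{v, w} \<in> E \<Longrightarrow> x \<in> words V \<Longrightarrow> y \<in> words V \<Longrightarrow>
     artin_eq V E lt (x @ wpow [(v, True), (w, True)] (lt {v, w}) @ y)
                     (x @ wpow [(w, True), (v, True)] (lt {v, w}) @ y)"

text \<open>Every homomorphism chi : A_Gamma \<rightarrow> Z is determined by m_v = chi(g_v), and
  every m : V \<rightarrow> Z defines one (the relators are balanced).\<close>
definition chi :: "('v \<Rightarrow> int) \<Rightarrow> 'v word \<Rightarrow> int" where
  "chi m w = sum_list (map (\<lambda>(v, b). if b then m v else - m v) w)"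

definition akernel :: "'v set \<Rightarrow> ('v \<Rightarrow> int) \<Rightarrow> 'v word set" where
  "akernel V m = {w \<in> words V. chi m w = 0}"

text \<open>Model: K-linear combinations of elements of the kernel (formal sums, as
  functions from words to K), modulo the subspace spanned by
  [u] - [w] (u, w the same element of A_Gamma) and [a b] - [a] - [b].
  This is K \<otimes>_Z (A^chi)^ab = H_1(A^chi; K).\<close>
definition delta :: "'v word \<Rightarrow> 'v word \<Rightarrow> 'k::field" where
  "delta u = (\<lambda>w. if w = u then 1 else 0)"

inductive h1_null :: "'v set \<Rightarrow> 'v set set \<Rightarrow> ('v set \<Rightarrow> nat) \<Rightarrow> ('v \<Rightarrow> int)
    \<Rightarrow> ('v word \<Rightarrow> 'k::field) \<Rightarrow> bool"
  for V E lt m where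
  n_zero: "h1_null V E lt m (\<lambda>_. 0)"
| n_add: "h1_null V E lt m c \<Longrightarrow> h1_null V E lt m d \<Longrightarrow> h1_null V E lt m (\<lambda>w. c w + d w)"
| n_smult: "h1_null V E lt m c \<Longrightarrow> h1_null V E lt m (\<lambda>w. a * c w)"
| n_eq: "artin_eq V E lt u w \<Longrightarrow> u \<in> akernel V m \<Longrightarrow> w \<in> akernel V m \<Longrightarrow>
     h1_null V E lt m (\<lambda>x. delta u x - delta w x)"
| n_mult: "a \<in> akernel V m \<Longrightarrow> b \<in> akernel V m \<Longrightarrow>
     h1_null V E lt m (\<lambda>x. delta (a @ b) x - delta a x - delta b x)"

definition chain_fun :: "('k::field \<times> 'v word) list \<Rightarrow> 'v word \<Rightarrow> 'k" where
  "chain_fun x = (\<lambda>w. sum_list (map fst (filter (\<lambda>(a, u). u = w) x)))"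

definition valid_chain :: "'v set \<Rightarrow> ('v \<Rightarrow> int) \<Rightarrow> ('k \<times> 'v word) list \<Rightarrow> bool" where
  "valid_chain V m x \<longleftrightarrow> snd ` set x \<subseteq> akernel V m"

text \<open>Laurent polynomials in K[t, t^{-1}] are finitely supported c : int \<Rightarrow> K
  (c k = coefficient of t^k); t acts by conjugation by g.\<close>
definition laurent :: "(int \<Rightarrow> 'k::field) \<Rightarrow> bool" where
  "laurent c \<longleftrightarrow> finite {k. c k \<noteq> 0}"

definition lact :: "'v word \<Rightarrow> (int \<Rightarrow> 'k::field) \<Rightarrow> ('k \<times> 'v word) list \<Rightarrow> ('k \<times> 'v word) list" where
  "lact g c x = concat (map (\<lambda>k. map (\<lambda>(a, w). (c k * a, wzpow g k @ w @ winv (wzpow g k))) x)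
                            (sorted_list_of_set {k. c k \<noteq> 0}))"

definition h1_indep :: "'v set \<Rightarrow> 'v set set \<Rightarrow> ('v set \<Rightarrow> nat) \<Rightarrow> ('v \<Rightarrow> int) \<Rightarrow> 'v word
    \<Rightarrow> ('k::field \<times> 'v word) list list \<Rightarrow> bool" where
  "h1_indep V E lt m g xs \<longleftrightarrow> (\<forall>x \<in> set xs. valid_chain V m x) \<and>
     (\<forall>cs :: (int \<Rightarrow> 'k) list. length cs = length xs \<longrightarrow> (\<forall>c \<in> set cs. laurent c) \<longrightarrow>
        h1_null V E lt m (chain_fun (concat (map2 (lact g) cs xs))) \<longrightarrow>
        (\<forall>c \<in> set cs. \<forall>k. c k = 0))"

text \<open>The rank of the free part of H_1 (over the PID K[t^{\<plusminus>1}]) is r: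
  the maximal size of a K[t^{\<plusminus>1}]-linearly independent family.\<close>
definition h1_free_rank_is :: "'v set \<Rightarrow> 'v set set \<Rightarrow> ('v set \<Rightarrow> nat) \<Rightarrow> ('v \<Rightarrow> int) \<Rightarrow> 'v word
    \<Rightarrow> 'k::field itself \<Rightarrow> nat \<Rightarrow> bool" where
  "h1_free_rank_is V E lt m g K r \<longleftrightarrow>
     (\<exists>xs :: ('k \<times> 'v word) list list. length xs = r \<and> h1_indep V E lt m g xs) \<and>
     (\<forall>xs :: ('k \<times> 'v word) list list. h1_indep V E lt m g xs \<longrightarrow> length xs \<le> r)"

definition h1_torsion :: "'v set \<Rightarrow> 'v set set \<Rightarrow> ('v set \<Rightarrow> nat) \<Rightarrow> ('v \<Rightarrow> int) \<Rightarrow> 'v word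
    \<Rightarrow> 'k::field itself \<Rightarrow> bool" where
  "h1_torsion V E lt m g K \<longleftrightarrow>
     (\<forall>x :: ('k \<times> 'v word) list. valid_chain V m x \<longrightarrow>
        (\<exists>c :: int \<Rightarrow> 'k. laurent c \<and> (\<exists>k. c k \<noteq> 0) \<and> h1_null V E lt m (chain_fun (lact g c x))))"

definition VR :: "'v set \<Rightarrow> ('v \<Rightarrow> int) \<Rightarrow> 'v set" where
  "VR V m = {v \<in> V. m v = 0}"

definition ER :: "'v set set \<Rightarrow> ('v set \<Rightarrow> nat) \<Rightarrow> ('v \<Rightarrow> int) \<Rightarrow> 'k::field itself \<Rightarrow> 'v set set" where
  "ER E lt m K = {e \<in> E. (\<Sum>v\<in>e. m v) = 0 \<and> of_nat (lt e) = (0 :: 'k)}"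

definition V1 :: "'v set \<Rightarrow> 'v set set \<Rightarrow> ('v \<Rightarrow> int) \<Rightarrow> 'v set" where
  "V1 V E m = V - {v \<in> VR V m. \<exists>w \<in> V - VR V m. {v, w} \<in> E}"

definition E1 :: "'v set \<Rightarrow> 'v set set \<Rightarrow> ('v set \<Rightarrow> nat) \<Rightarrow> ('v \<Rightarrow> int) \<Rightarrow> 'k::field itself \<Rightarrow> 'v set set" where
  "E1 V E lt m K = {e \<in> E. e \<subseteq> V1 V E m \<and> \<not> e \<subseteq> VR V m \<and> e \<notin> ER E lt m K}"

definition components1 :: "'v set \<Rightarrow> 'v set set \<Rightarrow> ('v set \<Rightarrow> nat) \<Rightarrow> ('v \<Rightarrow> int) \<Rightarrow> 'k::field itself \<Rightarrow> 'v set set" where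
  "components1 V E lt m K = V1 V E m //
     (({(v, w). {v, w} \<in> E1 V E lt m K})\<^sup>* \<inter> (V1 V E m \<times> V1 V E m))"

definition dim_rH0_Gamma1 :: "'v set \<Rightarrow> 'v set set \<Rightarrow> ('v set \<Rightarrow> nat) \<Rightarrow> ('v \<Rightarrow> int) \<Rightarrow> 'k::field itself \<Rightarrow> nat" where
  "dim_rH0_Gamma1 V E lt m K = card (components1 V E lt m K) - 1"

definition connected1 :: "'v set \<Rightarrow> 'v set set \<Rightarrow> ('v set \<Rightarrow> nat) \<Rightarrow> ('v \<Rightarrow> int) \<Rightarrow> 'k::field itself \<Rightarrow> bool" where
  "connected1 V E lt m K \<longleftrightarrow> card (components1 V E lt m K) = 1"

end

theory Submission
  imports Defs "HOL-Library.Poly_Mapping" HOL.Modules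
begin

text \<open>Let \<open>R = K[t\<^sup>\<plusminus>\<^sup>1]\<close>, let \<open>\<mu> = \<chi> / \<chi>(g)\<close>, and fix a vertex \<open>v0\<close> with
  \<open>\<mu>(v0) \<noteq> 0\<close>, \<open>h = g_v0\<close>. In \<open>H_1\<close> the map \<open>c(u) = [h u h^-1 u^-1]\<close> is a crossed
  homomorphism, \<open>c(u w) = c(u) + t^\<mu>(u) c(w)\<close>, and \<open>c(w) = (t^\<mu>(v0) - 1) [w]\<close> for \<open>w\<close> in the
  kernel. Hence up to torsion \<open>H_1\<close> is generated by the \<open>c(v)\<close>, subject for each edge to
  \<open>s_e ((1 - t^\<mu>(w)) c(v) - (1 - t^\<mu>(v)) c(w)) = 0\<close> with \<open>s_e = \<Sum>i<lt e. t^(i \<mu>(e))\<close>, which vanishes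
  exactly on resonant edges. So \<open>c(v)\<close> is torsion for every vertex removed in \<open>\<Gamma>_1\<close>, the \<open>c(v)\<close> of one
  component of \<open>\<Gamma>_1\<close> are proportional up to torsion, and \<open>c(v0) = 0\<close>: the rank is at most the
  number of components minus one.

  Conversely each component \<open>C\<close> carries a crossed homomorphism from the group to \<open>R\<close> with
  \<open>g_v \<mapsto> 1 - t^\<mu>(v)\<close> on \<open>C\<close> (or \<open>g_v \<mapsto> 1\<close> if \<open>C = {v}\<close> is resonant) and zero elsewhere. These are
  \<open>R\<close>-linear on \<open>H_1\<close>, and those of the components other than that of \<open>v0\<close> separate the classes
  \<open>c(v)\<close>, one \<open>v\<close> for each such component.\<close>

section \<open>Linear dependence over an integral domain\<close>

text \<open>Fraction-free Gaussian elimination: cross-multiplying with a pivot row clears one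
  column, so the coefficients stay in the domain and no fraction field has to be formed.\<close>

lemma idom_linear_dependence:
  fixes f :: "'i \<Rightarrow> 'j \<Rightarrow> 'a::idom"
  assumes "finite J" "finite I" "card J < card I"
  shows "\<exists>c. (\<exists>i\<in>I. c i \<noteq> 0) \<and> (\<forall>j\<in>J. (\<Sum>i\<in>I. c i * f i j) = 0)"
  using assms
proof (induction J arbitrary: I f rule: finite_induct)
  case empty
  then obtain i where "i \<in> I" by fastforce
  then show ?case by (intro exI[of _ "\<lambda>_. 1"]) auto
next
  case (insert j J)
  show ?case
  proof (cases "\<forall>i\<in>I. f i j = 0")
    case True
    have "card J < card I" using insert by simp
    from insert.IH[OF insert.prems(1) this, of f] True show ?thesis by force
  next
    case False
    then obtain i0 where i0: "i0 \<in> I" "f i0 j \<noteq> 0" by blast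
    define I' where "I' = I - {i0}"
    define a where "a = f i0 j"
    define f' where "f' i k = a * f i k - f i j * f i0 k" for i k
    have fin: "finite I'" using insert.prems by (simp add: I'_def)
    have card: "card J < card I'" using insert i0 by (simp add: I'_def)
    have split: "sum F I = F i0 + sum F I'" for F :: "'i \<Rightarrow> 'a"
      using sum.remove[OF insert.prems(1) i0(1)] by (simp add: I'_def)
    from insert.IH[OF fin card, of f'] obtain c
      where c: "\<exists>i\<in>I'. c i \<noteq> 0" "\<forall>k\<in>J. (\<Sum>i\<in>I'. c i * f' i k) = 0" by blast
    \<comment> \<open>The coefficient of the pivot row is chosen to cancel column \<open>j\<close>;
      the others are scaled by the pivot \<open>a\<close>, which is nonzero, so a nontrivial
      \<open>c\<close> stays nontrivial.\<close>
    define e where "e i = (if i = i0 then - (\<Sum>i\<in>I'. c i * f i j) else a * c i)" for i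
    have e: "(\<Sum>i\<in>I. e i * f i k) = (\<Sum>i\<in>I'. c i * f' i k)" for k
    proof -
      have "(\<Sum>i\<in>I'. e i * f i k) = (\<Sum>i\<in>I'. a * c i * f i k)"
        by (rule sum.cong) (auto simp: e_def I'_def)
      then show ?thesis
        by (simp add: split f'_def sum_distrib_left sum_distrib_right algebra_simps
            sum_subtractf e_def)
    qed
    have "f' i j = 0" for i by (simp add: f'_def a_def)
    then have "\<forall>k\<in>insert j J. (\<Sum>i\<in>I. e i * f i k) = 0" using c(2) e by simp
    moreover have "\<exists>i\<in>I. e i \<noteq> 0"
      using c(1) i0 by (auto simp: e_def I'_def a_def)
    ultimately show ?thesis by blast
  qed
qed

subsection \<open>Congruence modulo a submodule\<close>

text \<open>Working with congruences instead of a quotient type lets the same facts on crossed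
  homomorphisms serve the free module modulo its relations and the ring modulo
  \<open>{0}\<close>.\<close>

definition eqmod :: "'b::ab_group_add set \<Rightarrow> 'b \<Rightarrow> 'b \<Rightarrow> bool" where
  "eqmod N x y \<longleftrightarrow> x - y \<in> N"

context module
begin

lemma eqmod_refl: "subspace N \<Longrightarrow> eqmod N x x"
  by (simp add: eqmod_def subspace_0)

lemma eqmod_sym: "subspace N \<Longrightarrow> eqmod N x y \<Longrightarrow> eqmod N y x"
  unfolding eqmod_def using subspace_neg[of N "x - y"] by simp

lemma eqmod_trans: "subspace N \<Longrightarrow> eqmod N x y \<Longrightarrow> eqmod N y z \<Longrightarrow> eqmod N x z"
  unfolding eqmod_def using subspace_add[of N "x - y" "y - z"] by simp

lemma eqmod_add:
  "subspace N \<Longrightarrow> eqmod N x y \<Longrightarrow> eqmod N x' y' \<Longrightarrow> eqmod N (x + x') (y + y')"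
  unfolding eqmod_def using subspace_add[of N "x - y" "x' - y'"] by (simp add: algebra_simps)

lemma eqmod_scale: "subspace N \<Longrightarrow> eqmod N x y \<Longrightarrow> eqmod N (c *s x) (c *s y)"
  unfolding eqmod_def using subspace_scale[of N "x - y" c] by (simp add: scale_right_diff_distrib)

lemma eqmod_diff:
  "subspace N \<Longrightarrow> eqmod N x y \<Longrightarrow> eqmod N x' y' \<Longrightarrow> eqmod N (x - x') (y - y')"
  unfolding eqmod_def using subspace_diff[of N "x - y" "x' - y'"] by (simp add: algebra_simps)

lemma eqmod_mem: "subspace N \<Longrightarrow> eqmod N x y \<Longrightarrow> y \<in> N \<Longrightarrow> x \<in> N"
  unfolding eqmod_def using subspace_add[of N "x - y" y] by simp

end

subsection \<open>Words and the Artin relation\<close>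

lemma words_Nil [simp]: "[] \<in> words V"
  by (simp add: words_def)

lemma words_Cons [simp]: "x # w \<in> words V \<longleftrightarrow> fst x \<in> V \<and> w \<in> words V"
  by (simp add: words_def)

lemma words_append [simp]: "u @ w \<in> words V \<longleftrightarrow> u \<in> words V \<and> w \<in> words V"
  by (auto simp: words_def)

lemma winv_Nil [simp]: "winv [] = []"
  by (simp add: winv_def)

lemma winv_Cons [simp]: "winv ((v, b) # w) = winv w @ [(v, \<not> b)]"
  by (simp add: winv_def)

lemma winv_append [simp]: "winv (u @ w) = winv w @ winv u"
  by (simp add: winv_def)

lemma winv_winv [simp]: "winv (winv w) = w"
  by (induction w) auto

lemma words_winv [simp]: "winv w \<in> words V \<longleftrightarrow> w \<in> words V"
  by (induction w) auto

lemma wpow_0 [simp]: "wpow w 0 = []"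
  by (simp add: wpow_def)

lemma wpow_Suc [simp]: "wpow w (Suc n) = w @ wpow w n"
  by (simp add: wpow_def)

lemma words_wpow [simp]: "w \<in> words V \<Longrightarrow> wpow w n \<in> words V"
  by (induction n) auto

lemma words_wzpow [simp]: "w \<in> words V \<Longrightarrow> wzpow w k \<in> words V"
  by (simp add: wzpow_def)

lemma chi_Nil [simp]: "chi n [] = 0"
  by (simp add: chi_def)

lemma chi_Cons [simp]: "chi n ((v, b) # w) = (if b then n v else - n v) + chi n w"
  by (simp add: chi_def)

lemma chi_append [simp]: "chi n (u @ w) = chi n u + chi n w"
  by (simp add: chi_def)

lemma chi_winv [simp]: "chi n (winv w) = - chi n w"
  by (induction w) auto

lemma chi_wpow [simp]: "chi n (wpow w k) = int k * chi n w"
  by (induction k) (auto simp: algebra_simps)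

lemma chi_wzpow [simp]: "chi n (wzpow w k) = k * chi n w"
  by (simp add: wzpow_def)

lemma chi_scale:
  assumes "\<And>v. v \<in> V \<Longrightarrow> m v = d * n v" "w \<in> words V"
  shows "chi m w = d * chi n w"
  using assms(2) by (induction w) (auto simp: assms(1) algebra_simps)

section \<open>Crossed homomorphisms modulo a submodule\<close>

text \<open>\<open>D\<close> is a crossed homomorphism modulo \<open>N\<close> for which a word
  \<open>u\<close> acts as the scalar \<open>T (chi n u)\<close>. Iterating the product rule
  produces a geometric sum.\<close>

lemma (in module) derivation_wpow:
  assumes N: "subspace N"
    and T: "T 0 = 1" "\<And>a b. T (a + b) = T a * T b"
    and D: "\<And>u w. u \<in> words V \<Longrightarrow> w \<in> words V \<Longrightarrow> eqmod N (D (u @ w)) (D u + T (chi n u) *s D w)"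
    and u: "u \<in> words V"
  shows "eqmod N (D (wpow u l)) ((\<Sum>i<l. T (int i * chi n u)) *s D u)"
proof (induction l)
  case 0
  \<comment> \<open>The product rule at two empty words reads \<open>D [] = D [] + D []\<close>
    modulo \<open>N\<close>, so \<open>D []\<close> lies in \<open>N\<close>.\<close>
  have "eqmod N (D ([] @ [])) (D [] + T (chi n []) *s D [])" by (rule D) auto
  then have "- D [] \<in> N" by (simp add: eqmod_def T)
  then show ?case using subspace_neg[OF N] by (fastforce simp: eqmod_def)
next
  case (Suc l)
  have "eqmod N (D (u @ wpow u l)) (D u + T (chi n u) *s D (wpow u l))"
    by (rule D) (use u in auto)
  also have "eqmod N \<dots> (D u + T (chi n u) *s ((\<Sum>i<l. T (int i * chi n u)) *s D u))"
    by (intro eqmod_add eqmod_scale eqmod_refl N Suc.IH)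
  also (eqmod_trans[OF N]) have "D u + T (chi n u) *s ((\<Sum>i<l. T (int i * chi n u)) *s D u)
      = (\<Sum>i<Suc l. T (int i * chi n u)) *s D u"
  proof -
    have "(\<Sum>i<Suc l. T (int i * chi n u)) = 1 + T (chi n u) * (\<Sum>i<l. T (int i * chi n u))"
      unfolding sum.lessThan_Suc_shift
      by (simp add: T distrib_right sum_distrib_left)
    then show ?thesis by (simp only: scale_left_distrib scale_scale scale_one)
  qed
  finally show ?case by simp
qed

text \<open>The row of the Fox matrix that belongs to an edge.\<close>
lemma (in module) derivation_relator:
  assumes N: "subspace N"
    and T: "T 0 = 1" "\<And>a b. T (a + b) = T a * T b"
    and D: "\<And>u w. u \<in> words V \<Longrightarrow> w \<in> words V \<Longrightarrow> eqmod N (D (u @ w)) (D u + T (chi n u) *s D w)"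
    and V: "v \<in> V" "w \<in> V"
  shows "eqmod N (D (wpow [(v, True), (w, True)] l) - D (wpow [(w, True), (v, True)] l))
    ((\<Sum>i<l. T (int i * (n v + n w))) *s
       ((1 - T (n w)) *s D [(v, True)] - (1 - T (n v)) *s D [(w, True)]))"
proof -
  let ?s = "\<Sum>i<l. T (int i * (n v + n w))"
  \<comment> \<open>Stated for any two vertices of total weight \<open>n v + n w\<close>, so that
    both orders of the edge yield the same factor \<open>?s\<close>.\<close>
  have 2: "eqmod N (D (wpow [(a, True), (b, True)] l))
      (?s *s (D [(a, True)] + T (n a) *s D [(b, True)]))"
    if "a \<in> V" "b \<in> V" "n a + n b = n v + n w" for a b
  proof -
    have "eqmod N (D (wpow [(a, True), (b, True)] l)) (?s *s D [(a, True), (b, True)])"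
      using derivation_wpow[OF N T D, where u = "[(a, True), (b, True)]" and l = l] that by simp
    also
    have "eqmod N (D ([(a, True)] @ [(b, True)])) (D [(a, True)] + T (chi n [(a, True)]) *s D [(b, True)])"
      by (rule D) (use that in auto)
    then have "eqmod N (?s *s D [(a, True), (b, True)]) (?s *s (D [(a, True)] + T (n a) *s D [(b, True)]))"
      by (intro eqmod_scale N) simp
    finally (eqmod_trans[OF N]) show ?thesis .
  qed
  have "eqmod N (D (wpow [(v, True), (w, True)] l) - D (wpow [(w, True), (v, True)] l))
    (?s *s (D [(v, True)] + T (n v) *s D [(w, True)]) - ?s *s (D [(w, True)] + T (n w) *s D [(v, True)]))"
    by (intro eqmod_diff N 2 V) auto
  also have "?s *s (D [(v, True)] + T (n v) *s D [(w, True)]) - ?s *s (D [(w, True)] + T (n w) *s D [(v, True)])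
     = ?s *s ((1 - T (n w)) *s D [(v, True)] - (1 - T (n v)) *s D [(w, True)])"
    by (simp add: scale_right_diff_distrib scale_left_diff_distrib scale_right_distrib algebra_simps)
  finally show ?thesis .
qed

locale artin_graph =
  fixes V :: "'v set" and E :: "'v set set" and lt :: "'v set \<Rightarrow> nat"
  assumes edge: "e \<in> E \<Longrightarrow> \<exists>v w. v \<in> V \<and> w \<in> V \<and> v \<noteq> w \<and> e = {v, w}"
begin

abbreviation aeq (infix "\<simeq>" 50) where "u \<simeq> w \<equiv> artin_eq V E lt u w"

lemma edge_in: "{v, w} \<in> E \<Longrightarrow> v \<in> V \<and> w \<in> V \<and> v \<noteq> w"
  using edge[of "{v, w}"] by (auto simp: doubleton_eq_iff)

lemma artin_eq_words: "u \<simeq> w \<Longrightarrow> u \<in> words V \<and> w \<in> words V"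
  by (induction rule: artin_eq.induct) (auto dest: edge_in)

lemma artin_eq_context:
  "u \<simeq> w \<Longrightarrow> a \<in> words V \<Longrightarrow> b \<in> words V \<Longrightarrow> a @ u @ b \<simeq> a @ w @ b"
proof (induction rule: artin_eq.induct)
  case (a_cancel u w v c)
  then show ?case using artin_eq.a_cancel[of "a @ u" V "w @ b" v] by simp
next
  case (a_rel v w x y)
  then show ?case using artin_eq.a_rel[of v w E "a @ x" V "y @ b"] by simp
qed (auto intro: artin_eq.intros)

lemma artin_eq_append:
  assumes "u \<simeq> u'" "w \<simeq> w'" shows "u @ w \<simeq> u' @ w'"
  using artin_eq_context[OF assms(1), of "[]" w] artin_eq_context[OF assms(2), of u' "[]"]
    artin_eq_words[OF assms(1)] artin_eq_words[OF assms(2)]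
  by (auto intro: a_trans)

lemma artin_eq_right_inv: "u \<in> words V \<Longrightarrow> u @ winv u \<simeq> []"
proof (induction u)
  case (Cons x u)
  obtain v b where x: "x = (v, b)" by force
  have "[(v, b)] @ (u @ winv u) @ [(v, \<not> b)] \<simeq> [(v, b)] @ [] @ [(v, \<not> b)]"
    by (rule artin_eq_context) (use Cons x in auto)
  moreover have "[] @ [(v, b), (v, \<not> b)] @ [] \<simeq> [] @ []"
    by (rule a_cancel) (use Cons x in auto)
  ultimately show ?case using x by (auto intro: a_trans)
qed (auto intro: a_refl)

lemma artin_eq_left_inv: "u \<in> words V \<Longrightarrow> winv u @ u \<simeq> []"
  using artin_eq_right_inv[of "winv u"] by simp

lemma artin_eq_cancel_left:
  assumes "u \<in> words V" "w \<in> words V" shows "winv u @ u @ w \<simeq> w" "u @ winv u @ w \<simeq> w"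
  using artin_eq_append[OF artin_eq_left_inv a_refl] artin_eq_append[OF artin_eq_right_inv a_refl] assms
  by fastforce+

lemma artin_eq_cancel_mid:
  assumes "u \<in> words V" "x \<in> words V" "w \<in> words V"
  shows "x @ winv u @ u @ w \<simeq> x @ w" "x @ u @ winv u @ w \<simeq> x @ w"
  using artin_eq_append[OF a_refl artin_eq_cancel_left(1)] artin_eq_append[OF a_refl artin_eq_cancel_left(2)]
    assms by blast+

lemma artin_eq_winv:
  assumes "u \<simeq> w" shows "winv u \<simeq> winv w"
proof -
  note W = artin_eq_words[OF assms]
  have "winv u @ (w @ winv w) \<simeq> winv u @ []"
    by (intro artin_eq_append artin_eq_right_inv a_refl) (use W in auto)
  moreover have "winv u @ u @ winv w \<simeq> winv u @ w @ winv w"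
    by (intro artin_eq_append assms a_refl) (use W in auto)
  moreover have "winv u @ u @ winv w \<simeq> winv w"
    by (rule artin_eq_cancel_left) (use W in auto)
  ultimately show ?thesis by simp (meson a_sym a_trans)
qed

lemma artin_eq_wzpow_step:
  assumes "g \<in> words V"
  shows "wzpow g (k + 1) \<simeq> g @ wzpow g k"
proof (cases "0 \<le> k")
  case True
  then have "nat (k + 1) = Suc (nat k)" by simp
  with True assms show ?thesis by (auto simp: wzpow_def intro!: a_refl)
next
  case False
  then have k: "nat (- k) = Suc (nat (- (k + 1)))" by simp
  have "g @ winv g @ wpow (winv g) (nat (- (k + 1))) \<simeq> wpow (winv g) (nat (- (k + 1)))"
    by (rule artin_eq_cancel_left) (use assms in auto)
  moreover have "wzpow g (k + 1) = wpow (winv g) (nat (- (k + 1)))"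
    \<comment> \<open>For \<open>k = -1\<close> the exponent \<open>k + 1\<close> already falls
      under the nonnegative branch of \<open>wzpow\<close>; both branches give the empty word
      there.\<close>
    using False by (cases "k = -1") (auto simp: wzpow_def)
  ultimately show ?thesis using False k
    by (simp add: wzpow_def a_sym)
qed

lemma artin_eq_wzpow_add:
  assumes g: "g \<in> words V"
  shows "wzpow g j @ wzpow g k \<simeq> wzpow g (j + k)"
proof (induction j rule: int_induct[where k = 0])
  case base
  then show ?case using g by (simp add: wzpow_def a_refl)
next
  case (step1 i)
  have "wzpow g (i + 1) @ wzpow g k \<simeq> (g @ wzpow g i) @ wzpow g k"
    by (intro artin_eq_append artin_eq_wzpow_step a_refl) (use g in auto)
  moreover have "g @ wzpow g i @ wzpow g k \<simeq> g @ wzpow g (i + k)"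
    by (intro artin_eq_append step1.IH a_refl) (use g in auto)
  moreover have "wzpow g (i + k + 1) \<simeq> g @ wzpow g (i + k)"
    by (rule artin_eq_wzpow_step[OF g])
  ultimately show ?case by (auto simp: ac_simps intro: a_trans a_sym)
next
  case (step2 i)
  \<comment> \<open>The downward step inserts \<open>winv g @ g\<close> in front and absorbs the
    letter block \<open>g\<close> into the power, which reduces it to the induction
    hypothesis.\<close>
  let ?w = "wzpow g (i - 1) @ wzpow g k"
  have "winv g @ g @ ?w \<simeq> ?w"
    by (rule artin_eq_cancel_left) (use g in auto)
  moreover have "winv g @ (g @ wzpow g (i - 1)) @ wzpow g k \<simeq> winv g @ wzpow g (i - 1 + 1) @ wzpow g k"
    by (intro artin_eq_append artin_eq_wzpow_step[THEN a_sym] a_refl) (use g in auto)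
  moreover have "winv g @ wzpow g i @ wzpow g k \<simeq> winv g @ wzpow g (i + k)"
    by (intro artin_eq_append step2.IH a_refl) (use g in auto)
  moreover have "winv g @ wzpow g (i - 1 + k + 1) \<simeq> winv g @ g @ wzpow g (i - 1 + k)"
    by (intro artin_eq_append artin_eq_wzpow_step a_refl) (use g in auto)
  moreover have "winv g @ g @ wzpow g (i - 1 + k) \<simeq> wzpow g (i - 1 + k)"
    by (rule artin_eq_cancel_left) (use g in auto)
  ultimately show ?case
    by (simp add: algebra_simps) (meson a_sym a_trans)
qed

end

subsection \<open>The free module over Laurent polynomials\<close>

lemma poly_mapping_sum_single: "p = (\<Sum>k\<in>Poly_Mapping.keys p. Poly_Mapping.single k (Poly_Mapping.lookup p k))"
  by (rule poly_mapping_eqI)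
    (auto simp: lookup_sum lookup_single when_def sum.delta in_keys_iff)

lemma poly_mapping_add_induct [case_names zero single add]:
  fixes p :: "'a \<Rightarrow>\<^sub>0 'b::comm_monoid_add"
  assumes "P 0" "\<And>k a. P (Poly_Mapping.single k a)" "\<And>p q. P p \<Longrightarrow> P q \<Longrightarrow> P (p + q)"
  shows "P p"
proof -
  have "P (\<Sum>k\<in>A. Poly_Mapping.single k (Poly_Mapping.lookup p k))" for A
    by (induction A rule: infinite_finite_induct) (auto intro: assms)
  then show ?thesis using poly_mapping_sum_single[of p] by metis
qed

definition pscale :: "'r::comm_ring_1 \<Rightarrow> ('a \<Rightarrow>\<^sub>0 'r) \<Rightarrow> ('a \<Rightarrow>\<^sub>0 'r)" where
  "pscale p = Poly_Mapping.map ((*) p)"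

lemma lookup_pscale [simp]: "Poly_Mapping.lookup (pscale p z) w = p * Poly_Mapping.lookup z w"
  by (simp add: pscale_def Poly_Mapping.map.rep_eq when_def)

lemma pscale_single [simp]: "pscale p (Poly_Mapping.single w q) = Poly_Mapping.single w (p * q)"
  by (rule poly_mapping_eqI) (simp add: lookup_single when_def)

interpretation pm: module pscale
  by unfold_locales (auto intro!: poly_mapping_eqI simp: lookup_add algebra_simps)

text \<open>The linear functional on Laurent polynomials sending t^k to \<open>F k\<close>. With
  \<open>F k\<close> the value at a fixed word of the conjugate by the \<open>k\<close>-th power of
  \<open>g\<close>, it describes the action of a polynomial on chains.\<close>

definition ev :: "(int \<Rightarrow>\<^sub>0 'k::comm_ring_1) \<Rightarrow> (int \<Rightarrow> 'k) \<Rightarrow> 'k" where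
  "ev p F = (\<Sum>k\<in>Poly_Mapping.keys p. Poly_Mapping.lookup p k * F k)"

lemma ev_0 [simp]: "ev 0 F = 0"
  by (simp add: ev_def)

lemma ev_add: "ev (p + q) F = ev p F + ev q F"
  unfolding ev_def by (rule setsum_keys_plus_distrib) (auto simp: algebra_simps)

lemma ev_single [simp]: "ev (Poly_Mapping.single k a) F = a * F k"
  by (cases "a = 0") (auto simp: ev_def)

lemma ev_mult_single: "ev (p * Poly_Mapping.single j a) F = a * ev p (\<lambda>k. F (k + j))"
  by (induction p rule: poly_mapping_add_induct)
    (auto simp: mult_single ev_add algebra_simps)

lemma ev_fun_zero [simp]: "ev p (\<lambda>_. 0) = 0"
  by (simp add: ev_def)

lemma ev_fun_add: "ev p (\<lambda>k. F k + F' k) = ev p F + ev p F'"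
  by (simp add: ev_def algebra_simps sum.distrib)

lemma ev_fun_diff: "ev p (\<lambda>k. F k - F' k) = ev p F - ev p F'"
  by (simp add: ev_def algebra_simps sum_subtractf)

lemma ev_fun_scale: "ev p (\<lambda>k. a * F k) = a * ev p F"
  by (simp add: ev_def algebra_simps sum_distrib_left)

definition wconj :: "'v word \<Rightarrow> int \<Rightarrow> 'v word \<Rightarrow> 'v word" where
  "wconj g k w = wzpow g k @ w @ winv (wzpow g k)"

text \<open>Chains are lifted to the free \<open>K[t\<^sup>\<plusminus>\<^sup>1]\<close>-module on words, where scaling is strictly
  associative; on words themselves conjugation by powers of \<open>g\<close> is an action only up to the Artin
  relation. The map below projects back to chains.\<close>
definition realize :: "'v word \<Rightarrow> ('v word \<Rightarrow>\<^sub>0 (int \<Rightarrow>\<^sub>0 'k::field)) \<Rightarrow> 'v word \<Rightarrow> 'k" where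
  "realize g z x = (\<Sum>w\<in>Poly_Mapping.keys z. ev (Poly_Mapping.lookup z w) (\<lambda>k. delta (wconj g k w) x))"

lemma realize_0 [simp]: "realize g 0 x = 0"
  by (simp add: realize_def)

lemma realize_add: "realize g (y + z) x = realize g y x + realize g z x"
  unfolding realize_def by (rule setsum_keys_plus_distrib) (auto simp: ev_add)

lemma realize_diff: "realize g (y - z) x = realize g y x - realize g z x"
  using realize_add[of g "y - z" z x] by simp

lemma realize_single [simp]:
  "realize g (Poly_Mapping.single w p) x = ev p (\<lambda>k. delta (wconj g k w) x)"
  by (cases "p = 0") (auto simp: realize_def)

lemma realize_sum: "realize g (sum f A) x = (\<Sum>i\<in>A. realize g (f i) x)"
  by (induction A rule: infinite_finite_induct) (auto simp: realize_add)

definition chain_elem :: "('k::field \<times> 'v word) list \<Rightarrow> 'v word \<Rightarrow>\<^sub>0 (int \<Rightarrow>\<^sub>0 'k)" where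
  "chain_elem y = (\<Sum>(a, w)\<leftarrow>y. Poly_Mapping.single w (Poly_Mapping.single 0 a))"

lemma chain_fun_Nil [simp]: "chain_fun [] x = 0"
  by (simp add: chain_fun_def)

lemma chain_fun_Cons [simp]: "chain_fun ((a, u) # y) x = a * delta u x + chain_fun y x"
  by (simp add: chain_fun_def delta_def)

lemma chain_fun_append [simp]: "chain_fun (y @ z) x = chain_fun y x + chain_fun z x"
  by (simp add: chain_fun_def)

lemma chain_fun_concat_map2:
  "length cs = length xs \<Longrightarrow> chain_fun (concat (map2 (lact g) cs xs)) x
     = (\<Sum>i<length xs. chain_fun (lact g (cs ! i) (xs ! i)) x)"
  by (induction cs xs rule: list_induct2) (simp_all add: sum.lessThan_Suc_shift del: sum.lessThan_Suc)

lemma chain_fun_lact: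
  fixes c :: "int \<Rightarrow> 'k::field"
  assumes "laurent c"
  shows "chain_fun (lact g c y) x = (\<Sum>k | c k \<noteq> 0. c k * (\<Sum>(a, w)\<leftarrow>y. a * delta (wconj g k w) x))"
proof -
  have 1: "chain_fun (map (\<lambda>(a, w). (b * a, wzpow g k @ w @ winv (wzpow g k))) y) x
      = b * (\<Sum>(a, w)\<leftarrow>y. a * delta (wconj g k w) x)" for k and b :: 'k
    by (induction y) (auto simp: wconj_def algebra_simps)
  have "chain_fun (concat (map (\<lambda>k. map (\<lambda>(a, w). (c k * a, wzpow g k @ w @ winv (wzpow g k))) y) ks)) x
      = (\<Sum>k\<leftarrow>ks. c k * (\<Sum>(a, w)\<leftarrow>y. a * delta (wconj g k w) x))" for ks
    by (induction ks) (auto simp: 1)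
  then show ?thesis using assms
    by (simp add: lact_def laurent_def sum.distinct_set_conv_list[symmetric]
        sum_list_distinct_conv_sum_set)
qed

text \<open>The bridge from \<open>lact\<close>, which conjugates words, to honest scalar
  multiplication in the free module.\<close>

lemma realize_chain_elem:
  assumes "laurent c"
  shows "realize g (pscale (Abs_poly_mapping c) (chain_elem y)) x = chain_fun (lact g c y) x"
proof -
  have 1: "realize g (pscale p (chain_elem y)) x = ev p (\<lambda>k. \<Sum>(a, w)\<leftarrow>y. a * delta (wconj g k w) x)" for p
    by (induction y)
      (auto simp: chain_elem_def pm.scale_right_distrib realize_add ev_mult_single ev_fun_add
        ev_fun_scale ev_fun_zero)
  have "Poly_Mapping.lookup (Abs_poly_mapping c) = c" "Poly_Mapping.keys (Abs_poly_mapping c) = {k. c k \<noteq> 0}"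
    using assms by (auto simp: laurent_def in_keys_iff)
  then show ?thesis by (simp add: 1 chain_fun_lact[OF assms] ev_def)
qed

lemma keys_chain_elem: "Poly_Mapping.keys (chain_elem y) \<subseteq> snd ` set y"
proof (induction y)
  case (Cons p y)
  obtain a w where p: "p = (a, w)" by force
  have "Poly_Mapping.keys (chain_elem (p # y)) \<subseteq> {w} \<union> Poly_Mapping.keys (chain_elem y)"
    unfolding chain_elem_def p
    by (auto intro: order_trans[OF keys_add] dest!: subsetD[OF keys_add] split: if_splits)
  then show ?case using Cons p by auto
qed (simp add: chain_elem_def)

section \<open>The relations of the homology module\<close>

text \<open>\<open>mu\<close> is the character divided by its value \<open>d\<close> on
  \<open>g\<close>. It has the same kernel as \<open>m\<close> on words, and it records the power of
  t by which a word acts on homology.\<close>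

locale artin_char = artin_graph V E lt
  for V :: "'v set" and E :: "'v set set" and lt :: "'v set \<Rightarrow> nat" +
  fixes m :: "'v \<Rightarrow> int" and mu :: "'v \<Rightarrow> int" and g :: "'v word" and d :: int
    and K :: "'k::field itself"
  assumes fin: "finite V"
    and lt_pos: "e \<in> E \<Longrightarrow> 1 \<le> lt e"
    and g_words: "g \<in> words V"
    and d: "d \<noteq> 0"
    and m_mu: "v \<in> V \<Longrightarrow> m v = d * mu v"
    and mu_g: "chi mu g = 1"
begin

abbreviation T :: "int \<Rightarrow> (int \<Rightarrow>\<^sub>0 'k)" where
  "T k \<equiv> Poly_Mapping.single k 1"

lemma T_0: "T 0 = 1"
  by simp

lemma T_add: "T (a + b) = T a * T b"
  by (simp add: mult_single)

lemma T_inverse [simp]: "T a * T (- a) = 1" "T (- a) * T a = 1"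
  by (simp_all add: mult_single)

lemma T_inverse_left [simp]: "T a * (T (- a) * p) = p" "T (- a) * (T a * p) = p"
  by (simp_all add: mult.assoc[symmetric])

lemma T_ne_1: "k \<noteq> 0 \<Longrightarrow> 1 - T k \<noteq> 0"
  by (metis T_0 eq_iff_diff_eq_0 lookup_single_eq lookup_single_not_eq zero_neq_one)

lemma akernel_iff: "w \<in> akernel V m \<longleftrightarrow> w \<in> words V \<and> chi mu w = 0"
  using chi_scale[of V m d mu w, OF m_mu] d by (auto simp: akernel_def)

lemma akernel_Nil [simp]: "[] \<in> akernel V m"
  by (simp add: akernel_iff)

abbreviation null :: "('v word \<Rightarrow> 'k) \<Rightarrow> bool" where
  "null \<equiv> h1_null V E lt m"

text \<open>The first two families mirror \<open>n_eq\<close> and \<open>n_mult\<close>; the third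
  makes multiplication by \<open>T k\<close> agree with conjugation by the \<open>k\<close>-th power
  of \<open>g\<close>.\<close>

definition gens :: "('v word \<Rightarrow>\<^sub>0 (int \<Rightarrow>\<^sub>0 'k)) set" where
  "gens = {Poly_Mapping.single u 1 - Poly_Mapping.single w 1 | u w.
             u \<simeq> w \<and> u \<in> akernel V m \<and> w \<in> akernel V m}
    \<union> {Poly_Mapping.single (a @ b) 1 - Poly_Mapping.single a 1 - Poly_Mapping.single b 1 | a b.
             a \<in> akernel V m \<and> b \<in> akernel V m}
    \<union> {Poly_Mapping.single (wconj g k w) 1 - Poly_Mapping.single w (T k) | k w.
             w \<in> akernel V m}"

definition rels :: "('v word \<Rightarrow>\<^sub>0 (int \<Rightarrow>\<^sub>0 'k)) set" where
  "rels = pm.span gens"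

lemma subspace_rels [iff]: "pm.subspace rels"
  by (simp add: rels_def)

lemma null_diff: "null a \<Longrightarrow> null b \<Longrightarrow> null (\<lambda>x. a x - b x)"
  using n_add[OF _ n_smult[of V E lt m b "-1"]] by fastforce

lemma null_ev:
  assumes "\<And>k. null (F k)" shows "null (\<lambda>x. ev c (\<lambda>k. F k x))"
proof -
  have "null (\<lambda>x. \<Sum>k\<in>A. Poly_Mapping.lookup c k * F k x)" for A
  proof (induction A rule: infinite_finite_induct)
    case (insert j A)
    then show ?case using n_add[OF n_smult[OF assms]] by simp
  qed (auto intro: n_zero)
  then show ?thesis by (simp add: ev_def)
qed

lemma wconj_akernel: "w \<in> akernel V m \<Longrightarrow> wconj g k w \<in> akernel V m"
  using g_words by (auto simp: akernel_iff wconj_def)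

lemma wconj_artin_eq: "u \<simeq> w \<Longrightarrow> wconj g k u \<simeq> wconj g k w"
  unfolding wconj_def using g_words by (auto intro: artin_eq_context)

lemma wconj_append:
  assumes "a \<in> words V" "b \<in> words V"
  shows "wconj g k a @ wconj g k b \<simeq> wconj g k (a @ b)"
  using artin_eq_cancel_mid(1)[of "wzpow g k" "wzpow g k @ a" "b @ winv (wzpow g k)"] assms g_words
  by (simp add: wconj_def)

lemma wconj_wconj:
  assumes "w \<in> words V"
  shows "wconj g j (wconj g k w) \<simeq> wconj g (j + k) w"
proof -
  have "wzpow g j @ wzpow g k \<simeq> wzpow g (j + k)" by (rule artin_eq_wzpow_add[OF g_words])
  from artin_eq_append[OF artin_eq_append[OF this a_refl[OF assms]] artin_eq_winv[OF this]]
  show ?thesis by (simp add: wconj_def)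
qed

text \<open>A multiple of a generator is realized as a combination of its conjugates. Conjugation
  respects products and composition of powers only up to the Artin relation, and \<open>n_eq\<close>
  corrects the defect.\<close>

lemma realize_gens:
  assumes "z \<in> gens" shows "null (realize g (pscale c z))"
  using assms unfolding gens_def
proof (elim UnE CollectE exE conjE)
  fix u w assume z: "z = Poly_Mapping.single u 1 - Poly_Mapping.single w 1"
    and uw: "u \<simeq> w" "u \<in> akernel V m" "w \<in> akernel V m"
  have "null (\<lambda>x. ev c (\<lambda>k. delta (wconj g k u) x - delta (wconj g k w) x))"
    by (intro null_ev n_eq wconj_artin_eq wconj_akernel uw)
  moreover have "realize g (pscale c z) = (\<lambda>x. ev c (\<lambda>k. delta (wconj g k u) x - delta (wconj g k w) x))"
    by (simp add: z fun_eq_iff pm.scale_right_diff_distrib realize_diff ev_fun_diff)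
  ultimately show ?thesis by simp
next
  fix a b assume z: "z = Poly_Mapping.single (a @ b) 1 - Poly_Mapping.single a 1 - Poly_Mapping.single b 1"
    and ab: "a \<in> akernel V m" "b \<in> akernel V m"
  \<comment> \<open>The subtracted difference trades the product of the conjugates for the conjugate
    of the product.\<close>
  let ?F = "\<lambda>k x. (delta (wconj g k a @ wconj g k b) x - delta (wconj g k a) x - delta (wconj g k b) x)
     - (delta (wconj g k a @ wconj g k b) x - delta (wconj g k (a @ b)) x)"
  have "null (\<lambda>x. ev c (\<lambda>k. ?F k x))"
    using wconj_akernel[OF ab(1)] wconj_akernel[OF ab(2)] wconj_akernel[of "a @ b"] ab
    by (intro null_ev null_diff n_mult n_eq wconj_append) (auto simp: akernel_iff)
  moreover have "realize g (pscale c z) = (\<lambda>x. ev c (\<lambda>k. ?F k x))"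
    by (simp add: z fun_eq_iff pm.scale_right_diff_distrib realize_diff ev_fun_diff)
  ultimately show ?thesis by simp
next
  fix k w assume z: "z = Poly_Mapping.single (wconj g k w) 1 - Poly_Mapping.single w (T k)"
    and w: "w \<in> akernel V m"
  have "null (\<lambda>x. ev c (\<lambda>j. delta (wconj g j (wconj g k w)) x - delta (wconj g (j + k) w) x))"
    using w by (intro null_ev n_eq wconj_wconj wconj_akernel) (auto simp: akernel_iff)
  moreover have "realize g (pscale c z)
      = (\<lambda>x. ev c (\<lambda>j. delta (wconj g j (wconj g k w)) x - delta (wconj g (j + k) w) x))"
    by (simp add: z fun_eq_iff pm.scale_right_diff_distrib realize_diff ev_fun_diff ev_mult_single)
  ultimately show ?thesis by simp
qed

text \<open>A relation found by module calculations thus becomes a relation in H_1; the upper bound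
  on the rank rests on this.\<close>

lemma realize_rels:
  assumes "z \<in> rels" shows "null (realize g z)"
  using assms unfolding rels_def
proof (induction rule: pm.span_induct_alt)
  case base
  have "realize g 0 = (\<lambda>_. 0 :: 'k)" by (simp add: fun_eq_iff)
  then show ?case by (simp add: n_zero)
next
  case (step c x y)
  have "realize g (pscale c x + y) = (\<lambda>w. realize g (pscale c x) w + realize g y w)"
    by (simp add: fun_eq_iff realize_add)
  then show ?case using step by (simp add: n_add realize_gens)
qed

end

section \<open>Homology classes of kernel words and the conjugation action\<close>

context artin_char
begin

abbreviation eqv (infix "\<approx>" 50) where "x \<approx> y \<equiv> eqmod rels x y"

abbreviation cls :: "'v word \<Rightarrow> ('v word \<Rightarrow>\<^sub>0 (int \<Rightarrow>\<^sub>0 'k))" where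
  "cls w \<equiv> Poly_Mapping.single w 1"

lemmas eqv_trans [trans] = pm.eqmod_trans[OF subspace_rels]
lemmas eqv_sym = pm.eqmod_sym[OF subspace_rels]
lemmas eqv_refl = pm.eqmod_refl[OF subspace_rels]
lemmas eqv_add = pm.eqmod_add[OF subspace_rels]

lemma gens_eqv: "x - y \<in> gens \<Longrightarrow> x \<approx> y"
  by (simp add: eqmod_def rels_def pm.span_base)

lemma cls_eq: "u \<simeq> w \<Longrightarrow> u \<in> akernel V m \<Longrightarrow> w \<in> akernel V m \<Longrightarrow> cls u \<approx> cls w"
  by (rule gens_eqv) (auto simp: gens_def)

lemma cls_append: "a \<in> akernel V m \<Longrightarrow> b \<in> akernel V m \<Longrightarrow> cls (a @ b) \<approx> cls a + cls b"
  by (rule gens_eqv) (auto simp: gens_def algebra_simps diff_diff_eq)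

lemma cls_wconj: "w \<in> akernel V m \<Longrightarrow> cls (wconj g k w) \<approx> pscale (T k) (cls w)"
  by (rule gens_eqv) (auto simp: gens_def)

lemma cls_Nil: "cls [] \<approx> 0"
proof -
  have "- cls [] \<in> rels" using cls_append[of "[]" "[]"] by (simp add: eqmod_def)
  then have "- (- cls []) \<in> rels" by (rule pm.subspace_neg[OF subspace_rels])
  then show ?thesis by (simp add: eqmod_def)
qed

lemma cls_winv:
  assumes "a \<in> akernel V m" shows "cls (winv a) \<approx> - cls a"
proof -
  have a': "winv a \<in> akernel V m" using assms by (simp add: akernel_iff)
  have "cls a + cls (winv a) \<approx> cls (a @ winv a)"
    by (rule eqv_sym[OF cls_append[OF assms a']])
  also have "cls (a @ winv a) \<approx> cls []"
    using assms by (intro cls_eq artin_eq_right_inv) (auto simp: akernel_iff)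
  also have "cls [] \<approx> 0" by (rule cls_Nil)
  finally show ?thesis by (simp add: eqmod_def algebra_simps)
qed

text \<open>Inner automorphisms act trivially on first homology, as the classes of \<open>k\<close>
  and of its inverse cancel.\<close>

lemma cls_conj_akernel:
  assumes "k \<in> akernel V m" "a \<in> akernel V m" shows "cls (k @ a @ winv k) \<approx> cls a"
proof -
  have k': "winv k \<in> akernel V m" using assms by (simp add: akernel_iff)
  have "a @ winv k \<in> akernel V m" using assms by (simp add: akernel_iff)
  then have "cls (k @ a @ winv k) \<approx> cls k + cls (a @ winv k)"
    by (rule cls_append[OF assms(1)])
  also have "cls k + cls (a @ winv k) \<approx> cls k + (cls a + cls (winv k))"
    by (intro eqv_add eqv_refl cls_append assms k')
  also have "cls k + (cls a + cls (winv k)) \<approx> cls k + (cls a + - cls k)"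
    by (intro eqv_add eqv_refl cls_winv assms)
  also have "cls k + (cls a + - cls k) = cls a" by simp
  finally show ?thesis .
qed

text \<open>Write \<open>u\<close> as \<open>?k\<close> times a power of \<open>g\<close> with the
  same value of \<open>chi mu\<close>. The factor \<open>?k\<close> lies in the kernel and acts
  trivially, the power of \<open>g\<close> acts as a power of t.\<close>

lemma cls_conj:
  assumes "u \<in> words V" "a \<in> akernel V m"
  shows "cls (u @ a @ winv u) \<approx> pscale (T (chi mu u)) (cls a)"
proof -
  let ?z = "wzpow g (chi mu u)"
  let ?k = "u @ winv ?z"
  have aw: "a \<in> words V" "chi mu a = 0" using assms by (auto simp: akernel_iff)
  have k: "?k \<in> akernel V m" using assms g_words by (simp add: akernel_iff mu_g)
  have "u @ winv ?z @ ?z @ a @ winv ?z @ ?z @ winv u \<simeq> u @ a @ winv ?z @ ?z @ winv u"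
    by (rule artin_eq_cancel_mid) (use assms aw g_words in auto)
  moreover have "(u @ a) @ winv ?z @ ?z @ winv u \<simeq> (u @ a) @ winv u"
    by (rule artin_eq_cancel_mid) (use assms aw g_words in auto)
  ultimately have "u @ winv ?z @ ?z @ a @ winv ?z @ ?z @ winv u \<simeq> u @ a @ winv u"
    using a_trans by fastforce
  then have "u @ a @ winv u \<simeq> ?k @ wconj g (chi mu u) a @ winv ?k"
    by (simp add: wconj_def a_sym)
  then have "cls (u @ a @ winv u) \<approx> cls (?k @ wconj g (chi mu u) a @ winv ?k)"
    using assms aw g_words by (intro cls_eq) (auto simp: akernel_iff wconj_def)
  also have "\<dots> \<approx> cls (wconj g (chi mu u) a)"
    by (intro cls_conj_akernel k wconj_akernel assms)
  also have "\<dots> \<approx> pscale (T (chi mu u)) (cls a)"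
    by (rule cls_wconj[OF assms(2)])
  finally show ?thesis .
qed

definition gsum :: "'v \<Rightarrow> 'v \<Rightarrow> (int \<Rightarrow>\<^sub>0 'k)" where
  "gsum v w = (\<Sum>i<lt {v, w}. T (int i * (mu v + mu w)))"

text \<open>If the two weights cancel, every summand is 1 and the sum is the constant
  \<open>of_nat (lt {v, w})\<close>. Otherwise only \<open>i = 0\<close> contributes in degree 0, so
  the constant coefficient is 1.\<close>

lemma gsum_eq_0_iff:
  assumes "{v, w} \<in> E"
  shows "gsum v w = 0 \<longleftrightarrow> {v, w} \<in> ER E lt m K"
proof -
  have vw: "v \<in> V" "w \<in> V" "v \<noteq> w" using edge_in[OF assms] by auto
  then have "(\<Sum>x\<in>{v, w}. m x) = d * (mu v + mu w)" by (simp add: m_mu algebra_simps)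
  then have ER: "{v, w} \<in> ER E lt m K \<longleftrightarrow> mu v + mu w = 0 \<and> of_nat (lt {v, w}) = (0 :: 'k)"
    using assms d by (auto simp: ER_def)
  show ?thesis
  proof (cases "mu v + mu w = 0")
    case True
    then have "gsum v w = Poly_Mapping.single 0 (of_nat (lt {v, w}))" by (simp add: gsum_def)
    then show ?thesis using True ER
      by (metis lookup_single_eq lookup_zero single_zero)
  next
    case False
    have "Poly_Mapping.lookup (gsum v w) 0 = (\<Sum>i<lt {v, w}. if i = 0 then 1 else 0)"
      unfolding gsum_def lookup_sum using False
      by (intro sum.cong) (auto simp: lookup_single when_def)
    also have "\<dots> = 1" using lt_pos[OF assms] by (simp add: sum.delta)
    finally show ?thesis using ER False by auto
  qed
qed

end

subsection \<open>Commutators with a non-resonant vertex\<close>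

locale artin_char_base = artin_char V E lt m mu g d K
  for V :: "'v set" and E :: "'v set set" and lt :: "'v set \<Rightarrow> nat"
    and m :: "'v \<Rightarrow> int" and mu :: "'v \<Rightarrow> int" and g :: "'v word" and d :: int
    and K :: "'k::field itself" +
  fixes v0 :: 'v
  assumes v0: "v0 \<in> V" "mu v0 \<noteq> 0"
begin

text \<open>The commutator with the letter of \<open>v0\<close> lies in the kernel for every word
  \<open>u\<close>, so its class extends to the whole group what would otherwise be defined only on
  kernel words.\<close>

definition comm :: "'v word \<Rightarrow> 'v word" where
  "comm u = [(v0, True)] @ u @ winv [(v0, True)] @ winv u"

abbreviation ccls :: "'v word \<Rightarrow> ('v word \<Rightarrow>\<^sub>0 (int \<Rightarrow>\<^sub>0 'k))" where
  "ccls u \<equiv> cls (comm u)"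

lemma comm_akernel: "u \<in> words V \<Longrightarrow> comm u \<in> akernel V m"
  using v0 by (simp add: akernel_iff comm_def)

text \<open>The commutator identity [h, u w] = [h, u] u [h, w] u^-1, with conjugation by
  \<open>u\<close> evaluated by \<open>cls_conj\<close>.\<close>

lemma ccls_derivation:
  assumes "u \<in> words V" "w \<in> words V"
  shows "ccls (u @ w) \<approx> ccls u + pscale (T (chi mu u)) (ccls w)"
proof -
  let ?h = "[(v0, True)]"
  have h: "?h \<in> words V" using v0 by simp
  have 1: "(?h @ u @ winv ?h) @ winv u @ u @ (?h @ w @ winv ?h @ winv w @ winv u)
      \<simeq> (?h @ u @ winv ?h) @ (?h @ w @ winv ?h @ winv w @ winv u)"
    by (rule artin_eq_cancel_mid) (use assms h in \<open>auto simp: comm_def\<close>)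
  have 2: "(?h @ u) @ winv ?h @ ?h @ (w @ winv ?h @ winv w @ winv u)
      \<simeq> (?h @ u) @ (w @ winv ?h @ winv w @ winv u)"
    by (rule artin_eq_cancel_mid) (use assms h in \<open>auto simp: comm_def\<close>)
  have "comm u @ (u @ comm w @ winv u) \<simeq> comm (u @ w)"
    using a_trans[OF 1[unfolded append_assoc] 2[unfolded append_assoc]]
    unfolding comm_def append_assoc winv_append .
  then have eq: "comm (u @ w) \<simeq> comm u @ (u @ comm w @ winv u)" by (rule a_sym)
  have K: "u @ comm w @ winv u \<in> akernel V m"
    using comm_akernel[OF assms(2)] assms by (simp add: akernel_iff)
  have "ccls (u @ w) \<approx> cls (comm u @ (u @ comm w @ winv u))"
    using comm_akernel[OF assms(1)] comm_akernel[of "u @ w"] K assms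
    by (intro cls_eq eq) (auto simp: akernel_iff)
  also have "\<dots> \<approx> ccls u + cls (u @ comm w @ winv u)"
    by (intro cls_append comm_akernel K assms)
  also have "\<dots> \<approx> ccls u + pscale (T (chi mu u)) (ccls w)"
    by (intro eqv_add eqv_refl cls_conj comm_akernel assms)
  finally show ?thesis .
qed

lemma ccls_eq:
  assumes "u \<simeq> w" shows "ccls u \<approx> ccls w"
proof -
  note W = artin_eq_words[OF assms]
  have "comm u \<simeq> comm w"
    unfolding comm_def by (intro artin_eq_append artin_eq_winv a_refl assms) (use v0 in auto)
  then show ?thesis using W by (intro cls_eq comm_akernel) auto
qed

lemma ccls_Nil: "ccls [] \<approx> 0"
proof -
  have "[] @ [(v0, True), (v0, \<not> True)] @ [] \<simeq> [] @ []"
    by (rule a_cancel) (use v0 in auto)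
  then have "comm [] \<simeq> []" by (simp add: comm_def)
  then have "ccls [] \<approx> cls []" by (intro cls_eq comm_akernel) auto
  also have "\<dots> \<approx> 0" by (rule cls_Nil)
  finally show ?thesis .
qed

lemma ccls_v0: "ccls [(v0, True)] \<approx> 0"
proof -
  have "([(v0, True)] @ [(v0, True)]) @ winv ([(v0, True)] @ [(v0, True)]) \<simeq> []"
    by (rule artin_eq_right_inv) (use v0 in auto)
  then have "comm [(v0, True)] \<simeq> []" by (simp add: comm_def)
  then have "ccls [(v0, True)] \<approx> cls []" using v0 by (intro cls_eq comm_akernel) auto
  also have "\<dots> \<approx> 0" by (rule cls_Nil)
  finally show ?thesis .
qed

text \<open>For a kernel word the commutator splits into the two kernel elements h w h^-1 and w^-1.
  As \<open>mu v0\<close> is nonzero, so is the scalar, and \<open>cls w\<close> can be recovered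
  from \<open>ccls w\<close> up to torsion.\<close>

lemma ccls_akernel:
  assumes "w \<in> akernel V m"
  shows "ccls w \<approx> pscale (T (mu v0) - 1) (cls w)"
proof -
  let ?h = "[(v0, True)]"
  have hw: "?h @ w @ winv ?h \<in> akernel V m" and w': "winv w \<in> akernel V m"
    using assms v0 by (auto simp: akernel_iff)
  have "comm w = (?h @ w @ winv ?h) @ winv w" by (simp add: comm_def)
  then have "ccls w \<approx> cls (?h @ w @ winv ?h) + cls (winv w)"
    using cls_append[OF hw w'] by simp
  also have "\<dots> \<approx> pscale (T (chi mu ?h)) (cls w) + - cls w"
    using v0 by (intro eqv_add cls_conj cls_winv assms) auto
  also have "\<dots> = pscale (T (mu v0) - 1) (cls w)"
    unfolding pm.scale_left_diff_distrib pm.scale_one chi_Cons chi_Nil by simp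
  finally show ?thesis .
qed

lemma ccls_edge:
  assumes "{v, w} \<in> E"
  shows "pscale (gsum v w) (pscale (1 - T (mu w)) (ccls [(v, True)])
      - pscale (1 - T (mu v)) (ccls [(w, True)])) \<in> rels"
proof -
  have vw: "v \<in> V" "w \<in> V" using edge_in[OF assms] by auto
  let ?p = "wpow [(v, True), (w, True)] (lt {v, w})" and ?q = "wpow [(w, True), (v, True)] (lt {v, w})"
  have "[] @ ?p @ [] \<simeq> [] @ ?q @ []" by (rule a_rel[OF assms]) auto
  then have "ccls ?p \<approx> ccls ?q" by (intro ccls_eq) simp
  then have "ccls ?p - ccls ?q \<approx> 0" by (simp add: eqmod_def)
  moreover have "ccls ?p - ccls ?q \<approx> pscale (gsum v w) (pscale (1 - T (mu w)) (ccls [(v, True)])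
      - pscale (1 - T (mu v)) (ccls [(w, True)]))"
    unfolding gsum_def
    by (rule pm.derivation_relator[where D = ccls and T = T and n = mu,
          OF subspace_rels T_0 T_add ccls_derivation vw])
  ultimately have "pscale (gsum v w) (pscale (1 - T (mu w)) (ccls [(v, True)])
      - pscale (1 - T (mu v)) (ccls [(w, True)])) \<approx> 0"
    by (blast intro: eqv_trans eqv_sym)
  then show ?thesis unfolding eqmod_def diff_zero .
qed

text \<open>The elements that become combinations of \<open>X\<close> in \<open>H_1\<close> over the fraction field.\<close>
definition sat :: "('v word \<Rightarrow>\<^sub>0 (int \<Rightarrow>\<^sub>0 'k)) set \<Rightarrow> ('v word \<Rightarrow>\<^sub>0 (int \<Rightarrow>\<^sub>0 'k)) set" where
  "sat X = {z. \<exists>p. p \<noteq> 0 \<and> pscale p z \<in> pm.span (gens \<union> X)}"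

text \<open>For a sum the two denominators are multiplied; their product is nonzero because Laurent
  polynomials form a domain.\<close>

lemma subspace_sat [iff]: "pm.subspace (sat X)"
  unfolding pm.subspace_def
proof (intro conjI ballI allI)
  show "0 \<in> sat X" by (auto simp: sat_def pm.span_zero intro: exI[of _ 1])
  fix x assume "x \<in> sat X"
  then obtain p where p: "p \<noteq> 0" "pscale p x \<in> pm.span (gens \<union> X)" by (auto simp: sat_def)
  show "pscale c x \<in> sat X" for c
  proof -
    have "pscale c (pscale p x) \<in> pm.span (gens \<union> X)" by (rule pm.span_scale[OF p(2)])
    then have "pscale p (pscale c x) \<in> pm.span (gens \<union> X)" by (simp add: mult.commute)
    then show ?thesis using p by (auto simp: sat_def)
  qed
  fix y assume "y \<in> sat X"
  then obtain q where q: "q \<noteq> 0" "pscale q y \<in> pm.span (gens \<union> X)" by (auto simp: sat_def)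
  have "pscale q (pscale p x) + pscale p (pscale q y) \<in> pm.span (gens \<union> X)"
    by (intro pm.span_add pm.span_scale p q)
  then have "pscale (p * q) (x + y) \<in> pm.span (gens \<union> X)"
    by (simp add: pm.scale_right_distrib mult.commute)
  then show "x + y \<in> sat X" using p q by (auto simp: sat_def intro!: exI[of _ "p * q"])
qed

lemma span_sat: "z \<in> pm.span (gens \<union> X) \<Longrightarrow> z \<in> sat X"
  by (auto simp: sat_def intro: exI[of _ 1])

lemma rels_sat: "z \<in> rels \<Longrightarrow> z \<in> sat X"
  using pm.span_mono[of gens "gens \<union> X"] by (auto simp: rels_def intro: span_sat)

lemma sat_eqv: "x \<approx> y \<Longrightarrow> y \<in> sat X \<Longrightarrow> x \<in> sat X"
  by (rule pm.eqmod_mem[OF subspace_sat]) (auto simp: eqmod_def rels_sat)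

lemma sat_scaleD:
  assumes "pscale p z \<in> sat X" "p \<noteq> 0" shows "z \<in> sat X"
proof -
  obtain q where "q \<noteq> 0" "pscale q (pscale p z) \<in> pm.span (gens \<union> X)"
    using assms by (auto simp: sat_def)
  then show ?thesis using assms(2) by (auto simp: sat_def intro!: exI[of _ "q * p"])
qed

text \<open>In the edge relation the nonzero factors \<open>gsum v w\<close> and
  \<open>1 - T (mu w)\<close> can be divided out. If \<open>mu v = 0\<close>, the term of
  \<open>w\<close> disappears and the class of \<open>v\<close> is torsion; otherwise membership
  passes from \<open>w\<close> to \<open>v\<close>. These are the cases of a deleted vertex and of
  an edge of \<Gamma>_1.\<close>

lemma ccls_edge_sat:
  assumes "{v, w} \<in> E" "{v, w} \<notin> ER E lt m K" "mu w \<noteq> 0"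
    and "mu v = 0 \<or> ccls [(w, True)] \<in> sat X"
  shows "ccls [(v, True)] \<in> sat X"
proof -
  let ?x = "pscale (1 - T (mu w)) (ccls [(v, True)])"
  let ?y = "pscale (1 - T (mu v)) (ccls [(w, True)])"
  have g: "gsum v w \<noteq> 0" using gsum_eq_0_iff[OF assms(1)] assms(2) by simp
  have "pscale (gsum v w) (?x - ?y) \<in> sat X" by (intro rels_sat ccls_edge assms)
  then have "?x - ?y \<in> sat X" by (rule sat_scaleD[OF _ g])
  moreover have "?y \<in> sat X"
  proof (cases "mu v = 0")
    case True
    then show ?thesis using pm.subspace_0[OF subspace_sat] by simp
  next
    case False
    then show ?thesis using assms(4) by (intro pm.subspace_scale[OF subspace_sat]) auto
  qed
  ultimately have "?x \<in> sat X" using pm.subspace_add[OF subspace_sat] by fastforce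
  then show ?thesis using sat_scaleD T_ne_1[OF assms(3)] by blast
qed

lemma ccls_words_sat:
  assumes X: "\<And>v. v \<in> V \<Longrightarrow> ccls [(v, True)] \<in> sat X" and "w \<in> words V"
  shows "ccls w \<in> sat X"
  using assms(2)
proof (induction w)
  case Nil
  show ?case by (rule sat_eqv[OF ccls_Nil pm.subspace_0[OF subspace_sat]])
next
  case (Cons x w)
  obtain v b where x: "x = (v, b)" by force
  have v: "v \<in> V" and w: "w \<in> words V" using Cons x by auto
  have *: "ccls [(v, b)] \<in> sat X"
  proof (cases b)
    case True then show ?thesis using X v by simp
  next
    case False
    \<comment> \<open>Expanding the class of g_v g_v^-1 by the product rule determines the class of
      the inverse letter from that of g_v.\<close>
    have "0 \<approx> ccls []" by (rule eqv_sym[OF ccls_Nil])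
    also have "[] @ [] \<simeq> [] @ [(v, True), (v, \<not> True)] @ []"
      by (rule a_sym[OF a_cancel]) (use v in auto)
    then have "ccls [] \<approx> ccls ([(v, True)] @ [(v, False)])" by (intro ccls_eq) simp
    also have "\<dots> \<approx> ccls [(v, True)] + pscale (T (chi mu [(v, True)])) (ccls [(v, False)])"
      by (rule ccls_derivation) (use v in auto)
    finally have "ccls [(v, True)] + pscale (T (mu v)) (ccls [(v, False)]) \<in> sat X"
      by (intro sat_eqv[OF eqv_sym pm.subspace_0[OF subspace_sat]]) simp
    from pm.subspace_diff[OF subspace_sat this X[OF v]]
    have "pscale (T (mu v)) (ccls [(v, False)]) \<in> sat X" by (simp add: add_diff_cancel_left')
    moreover have "T (mu v) \<noteq> 0" by (metis lookup_single_eq lookup_zero zero_neq_one)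
    ultimately show ?thesis using sat_scaleD False by simp
  qed
  have "ccls ([(v, b)] @ w) \<approx> ccls [(v, b)] + pscale (T (chi mu [(v, b)])) (ccls w)"
    by (rule ccls_derivation) (use v w in auto)
  then show ?case unfolding x
    using sat_eqv pm.subspace_add[OF subspace_sat * pm.subspace_scale[OF subspace_sat Cons.IH[OF w]]]
    by (metis append_Cons append_Nil)
qed

text \<open>Kernel words reduce to commutators on dividing by \<open>T (mu v0) - 1\<close>, and
  commutators reduce to those of single letters by the product rule.\<close>

lemma all_sat:
  assumes X: "\<And>v. v \<in> V \<Longrightarrow> ccls [(v, True)] \<in> sat X"
    and z: "Poly_Mapping.keys z \<subseteq> akernel V m"
  shows "z \<in> sat X"
proof -
  have "cls w \<in> sat X" if w: "w \<in> akernel V m" for w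
  proof -
    have "pscale (T (mu v0) - 1) (cls w) \<in> sat X"
      using w ccls_words_sat[OF X, of w]
      by (intro sat_eqv[OF eqv_sym[OF ccls_akernel]]) (auto simp: akernel_iff)
    moreover have "T (mu v0) - 1 \<noteq> 0" using T_ne_1[OF v0(2)] by simp
    ultimately show ?thesis by (rule sat_scaleD)
  qed
  then have "pscale p (cls w) \<in> sat X" if "w \<in> akernel V m" for p w
    using that by (intro pm.subspace_scale[OF subspace_sat])
  then have "Poly_Mapping.single w p \<in> sat X" if "w \<in> akernel V m" for p w
    using that by (metis mult.right_neutral pscale_single)
  then have "(\<Sum>w\<in>Poly_Mapping.keys z. Poly_Mapping.single w (Poly_Mapping.lookup z w)) \<in> sat X"
    using z by (intro pm.subspace_sum[OF subspace_sat]) auto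
  then show ?thesis using poly_mapping_sum_single[of z] by simp
qed

text \<open>The dimension bound over the fraction field with denominators cleared:
  \<open>p i\<close> is a denominator of \<open>z i\<close>, \<open>q i\<close> its coordinates on
  \<open>X\<close>, and a dependence \<open>c\<close> among the rows \<open>q i\<close> gives the
  coefficients \<open>c i * p i\<close>.\<close>

lemma sat_dependence:
  assumes X: "finite X" "card X < n" and z: "\<And>i. i < n \<Longrightarrow> z i \<in> sat X"
  obtains c where "\<exists>i<n. c i \<noteq> 0" "(\<Sum>i<n. pscale (c i) (z i)) \<in> rels"
proof -
  have "\<forall>i\<in>{..<n}. \<exists>r. fst r \<noteq> 0 \<and> pscale (fst r) (z i) - (\<Sum>x\<in>X. pscale (snd r x) x) \<in> rels"
  proof
    fix i assume "i \<in> {..<n}"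
    then have i: "i < n" by simp
    obtain p where p: "p \<noteq> 0" "pscale p (z i) \<in> pm.span (gens \<union> X)"
      using z[OF i] by (auto simp: sat_def)
    then obtain a b where ab: "pscale p (z i) = a + b" "a \<in> rels" "b \<in> pm.span X"
      by (auto simp: pm.span_Un rels_def)
    then obtain q where "b = (\<Sum>x\<in>X. pscale (q x) x)" by (auto simp: pm.span_finite[OF X(1)])
    then have "pscale p (z i) - (\<Sum>x\<in>X. pscale (q x) x) \<in> rels" using ab by simp
    then show "\<exists>r. fst r \<noteq> 0 \<and> pscale (fst r) (z i) - (\<Sum>x\<in>X. pscale (snd r x) x) \<in> rels"
      using p(1) by (intro exI[of _ "(p, q)"]) simp
  qed
  from bchoice[OF this] obtain r where r: "\<forall>i\<in>{..<n}. fst (r i) \<noteq> 0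
      \<and> pscale (fst (r i)) (z i) - (\<Sum>x\<in>X. pscale (snd (r i) x) x) \<in> rels" by blast
  define p q where "p i = fst (r i)" and "q i = snd (r i)" for i
  have p: "\<And>i. i < n \<Longrightarrow> p i \<noteq> 0"
    and pq: "\<And>i. i < n \<Longrightarrow> pscale (p i) (z i) - (\<Sum>x\<in>X. pscale (q i x) x) \<in> rels"
    using r by (simp_all add: p_def q_def)
  obtain c where c: "\<exists>i\<in>{..<n}. c i \<noteq> 0" "\<forall>x\<in>X. (\<Sum>i<n. c i * q i x) = 0"
    using idom_linear_dependence[OF X(1), of "{..<n}" q] X by auto
  have "(\<Sum>i<n. pscale (c i) (pscale (p i) (z i) - (\<Sum>x\<in>X. pscale (q i x) x))) \<in> rels"
    by (intro pm.subspace_sum[OF subspace_rels] pm.subspace_scale[OF subspace_rels] pq) auto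
  moreover have "(\<Sum>i<n. pscale (c i) (pscale (p i) (z i) - (\<Sum>x\<in>X. pscale (q i x) x)))
      = (\<Sum>i<n. pscale (c i * p i) (z i))"
  proof -
    have "(\<Sum>i<n. \<Sum>x\<in>X. pscale (c i * q i x) x) = (\<Sum>x\<in>X. pscale (\<Sum>i<n. c i * q i x) x)"
      by (subst sum.swap) (simp add: pm.scale_sum_left)
    also have "\<dots> = 0" using c(2) by simp
    finally show ?thesis
      by (simp add: pm.scale_right_diff_distrib sum_subtractf pm.scale_sum_right)
  qed
  moreover have "\<exists>i<n. c i * p i \<noteq> 0" using c(1) p by auto
  ultimately show ?thesis by (intro that[of "\<lambda>i. c i * p i"]) simp_all
qed

end

subsection \<open>Crossed homomorphisms to Laurent polynomials\<close>

lemma module_mult: "module ((*) :: 'a::comm_ring_1 \<Rightarrow> 'a \<Rightarrow> 'a)"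
  by unfold_locales (auto simp: algebra_simps)

context artin_char
begin

text \<open>The Fox-type extension of prescribed values on the generators to a crossed homomorphism;
  the value on an inverse letter is forced by cancellation.\<close>

primrec fox :: "('v \<Rightarrow> (int \<Rightarrow>\<^sub>0 'k)) \<Rightarrow> 'v word \<Rightarrow> (int \<Rightarrow>\<^sub>0 'k)" where
  "fox \<delta> [] = 0"
| "fox \<delta> (x # w) = (if snd x then \<delta> (fst x) else - (T (- mu (fst x)) * \<delta> (fst x)))
     + T (if snd x then mu (fst x) else - mu (fst x)) * fox \<delta> w"

lemma fox_append: "fox \<delta> (u @ w) = fox \<delta> u + T (chi mu u) * fox \<delta> w"
proof (induction u)
  case (Cons x u)
  obtain v b where "x = (v, b)" by force
  then show ?case using Cons by (simp add: T_add algebra_simps)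
qed simp

lemma fox_winv: "fox \<delta> (winv u) = - (T (- chi mu u) * fox \<delta> u)"
proof -
  have "fox \<delta> (u @ winv u) = 0"
  proof (induction u)
    case (Cons x u)
    obtain v b where x: "x = (v, b)" by force
    have "fox \<delta> ((x # u) @ winv (x # u)) = fox \<delta> ([x] @ (u @ winv u) @ [(v, \<not> b)])"
      by (simp add: x)
    also have "\<dots> = fox \<delta> [x] + T (chi mu [x]) * fox \<delta> [(v, \<not> b)]"
      unfolding fox_append[of _ "[x]"] fox_append[of _ "u @ winv u"] Cons.IH by simp
    also have "\<dots> = 0"
      by (auto simp: x)
    finally show ?case .
  qed simp
  then have "T (- chi mu u) * (fox \<delta> u + T (chi mu u) * fox \<delta> (winv u)) = 0"
    by (simp add: fox_append)
  then show ?thesis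
    by (simp add: distrib_left add_eq_0_iff)
qed

text \<open>The crossed homomorphism agrees on the two sides of each edge relation, hence descends
  to the group.\<close>

definition compatible :: "('v \<Rightarrow> (int \<Rightarrow>\<^sub>0 'k)) \<Rightarrow> bool" where
  "compatible \<delta> \<longleftrightarrow> (\<forall>v w. {v, w} \<in> E \<longrightarrow>
     gsum v w * ((1 - T (mu w)) * \<delta> v - (1 - T (mu v)) * \<delta> w) = 0)"

lemma fox_artin_eq:
  assumes "compatible \<delta>" "u \<simeq> w"
  shows "chi mu u = chi mu w \<and> fox \<delta> u = fox \<delta> w"
  using assms(2)
proof (induction rule: artin_eq.induct)
  case (a_cancel u w v b)
  have "fox \<delta> [(v, b), (v, \<not> b)] = 0"
    by auto
  moreover have "chi mu [(v, b), (v, \<not> b)] = 0" by simp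
  ultimately show ?case unfolding fox_append chi_append by simp
next
  case (a_rel v w x y)
  have vw: "v \<in> V" "w \<in> V" using edge_in[OF a_rel(1)] by auto
  let ?p = "wpow [(v, True), (w, True)] (lt {v, w})" and ?q = "wpow [(w, True), (v, True)] (lt {v, w})"
  have D: "eqmod {0} (fox \<delta> (u @ w)) (fox \<delta> u + T (chi mu u) * fox \<delta> w)" for u w
    by (simp add: eqmod_def fox_append)
  have "eqmod {0} (fox \<delta> ?p - fox \<delta> ?q)
     (gsum v w * ((1 - T (mu w)) * fox \<delta> [(v, True)] - (1 - T (mu v)) * fox \<delta> [(w, True)]))"
    unfolding gsum_def
    by (rule module.derivation_relator[OF module_mult, where D = "fox \<delta>" and T = T and n = mu,
          OF module.subspace_single_0[OF module_mult] T_0 T_add D vw])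
  moreover have "gsum v w * ((1 - T (mu w)) * \<delta> v - (1 - T (mu v)) * \<delta> w) = 0"
    using assms(1) a_rel(1) unfolding compatible_def by blast
  ultimately have "fox \<delta> ?p = fox \<delta> ?q"
    by (simp add: eqmod_def del: mult_eq_0_iff)
  moreover have "chi mu ?p = chi mu ?q" by (simp add: add.commute)
  ultimately show ?case unfolding fox_append chi_append by (simp del: chi_wpow)
qed auto

text \<open>Since \<open>w\<close> has weight 0, the contributions of the conjugating power and of
  its inverse cancel. On the kernel the crossed homomorphism is therefore linear over Laurent
  polynomials.\<close>

lemma fox_wconj:
  assumes "w \<in> akernel V m"
  shows "fox \<delta> (wconj g k w) = T k * fox \<delta> w"
  using assms by (simp add: wconj_def fox_append fox_winv akernel_iff mu_g right_diff_distrib)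

text \<open>The linear extension of \<open>fox\<close> to formal sums. On an infinite support the
  sum defaults to 0, so the rules below carry finiteness hypotheses.\<close>

definition pairing :: "('v \<Rightarrow> (int \<Rightarrow>\<^sub>0 'k)) \<Rightarrow> ('v word \<Rightarrow> 'k) \<Rightarrow> (int \<Rightarrow>\<^sub>0 'k)" where
  "pairing \<delta> f = (\<Sum>w | f w \<noteq> 0. Poly_Mapping.single 0 (f w) * fox \<delta> w)"

lemma pairing_superset:
  "finite A \<Longrightarrow> {w. f w \<noteq> 0} \<subseteq> A \<Longrightarrow> pairing \<delta> f = (\<Sum>w\<in>A. Poly_Mapping.single 0 (f w) * fox \<delta> w)"
  unfolding pairing_def by (rule sum.mono_neutral_left) auto

lemma pairing_0 [simp]: "pairing \<delta> (\<lambda>_. 0) = 0"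
  by (simp add: pairing_def)

lemma pairing_add:
  assumes "finite {w. f w \<noteq> 0}" "finite {w. h w \<noteq> 0}"
  shows "pairing \<delta> (\<lambda>w. f w + h w) = pairing \<delta> f + pairing \<delta> h"
proof -
  let ?A = "{w. f w \<noteq> 0} \<union> {w. h w \<noteq> 0}"
  have A: "finite ?A" using assms by simp
  show ?thesis
    by (subst (1 2 3) pairing_superset[OF A])
      (auto simp: single_add distrib_right sum.distrib)
qed

lemma pairing_scale:
  assumes "finite {w. f w \<noteq> 0}"
  shows "pairing \<delta> (\<lambda>w. a * f w) = Poly_Mapping.single 0 a * pairing \<delta> f"
proof -
  have "Poly_Mapping.single (0::int) (a * f w) = Poly_Mapping.single 0 a * Poly_Mapping.single 0 (f w)" for w
    by (simp add: mult_single)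
  then show ?thesis
    by (subst (1 2) pairing_superset[OF assms]) (auto simp: sum_distrib_left mult.assoc)
qed

lemma finite_delta [simp]: "finite {w :: 'v word. delta u w \<noteq> (0::'k)}"
  by (simp add: delta_def)

lemma pairing_delta [simp]: "pairing \<delta> (delta u) = fox \<delta> u"
proof -
  have "{w. delta u w \<noteq> (0::'k)} = {u}" by (auto simp: delta_def)
  then show ?thesis by (simp add: pairing_def delta_def)
qed

lemma finite_support_comb:
  fixes f h :: "'v word \<Rightarrow> 'k"
  assumes "finite {w. f w \<noteq> 0}" "finite {w. h w \<noteq> 0}"
  shows "finite {w. f w + h w \<noteq> 0}" "finite {w. f w - h w \<noteq> 0}" "finite {w. a * f w \<noteq> 0}"
  using assms by (auto intro: finite_subset[of _ "{w. f w \<noteq> 0} \<union> {w. h w \<noteq> 0}"])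

lemma pairing_diff:
  assumes "finite {w. f w \<noteq> 0}" "finite {w. h w \<noteq> 0}"
  shows "pairing \<delta> (\<lambda>w. f w - h w) = pairing \<delta> f - pairing \<delta> h"
  using pairing_add[of "\<lambda>w. f w - h w" h] finite_support_comb(2)[OF assms] assms by simp

text \<open>Finiteness is part of the induction because additivity requires it. The product
  relations vanish since \<open>fox\<close> is additive on words of weight 0.\<close>

lemma pairing_null:
  assumes \<delta>: "compatible \<delta>" and "null f"
  shows "finite {w. f w \<noteq> 0} \<and> pairing \<delta> f = 0"
  using assms(2)
proof (induction rule: h1_null.induct)
  case n_zero
  then show ?case by (simp add: pairing_def)
next
  case (n_add c d)
  then show ?case by (simp add: pairing_add finite_support_comb)
next
  case (n_smult c a)
  then show ?case by (auto simp: pairing_scale intro: finite_subset)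
next
  case (n_eq u w)
  then show ?case using fox_artin_eq[OF \<delta> n_eq(1)]
      finite_support_comb(2)[OF finite_delta finite_delta]
    by (simp add: pairing_diff)
next
  case (n_mult a b)
  then show ?case
    using finite_support_comb(2)[OF finite_delta finite_delta]
      finite_support_comb(2)[OF finite_support_comb(2)[OF finite_delta finite_delta] finite_delta]
    by (simp add: pairing_diff fox_append akernel_iff)
qed

lemma pairing_sum:
  assumes "finite A" "\<And>i. i \<in> A \<Longrightarrow> finite {w. F i w \<noteq> 0}"
  shows "finite {w. (\<Sum>i\<in>A. F i w) \<noteq> 0}"
    and "pairing \<delta> (\<lambda>w. \<Sum>i\<in>A. F i w) = (\<Sum>i\<in>A. pairing \<delta> (F i))"
proof -
  have "finite {w. (\<Sum>i\<in>A. F i w) \<noteq> 0} \<and> pairing \<delta> (\<lambda>w. \<Sum>i\<in>A. F i w) = (\<Sum>i\<in>A. pairing \<delta> (F i))"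
    using assms by (induction A rule: finite_induct)
      (auto simp: pairing_add finite_support_comb)
  then show "finite {w. (\<Sum>i\<in>A. F i w) \<noteq> 0}"
    and "pairing \<delta> (\<lambda>w. \<Sum>i\<in>A. F i w) = (\<Sum>i\<in>A. pairing \<delta> (F i))" by auto
qed

lemma pairing_lact:
  assumes "laurent c" "w \<in> akernel V m"
  shows "finite {x. chain_fun (lact g c [(1, w)]) x \<noteq> 0}"
    and "pairing \<delta> (chain_fun (lact g c [(1, w)])) = Abs_poly_mapping c * fox \<delta> w"
proof -
  have eq: "chain_fun (lact g c [(1, w)]) = (\<lambda>x. \<Sum>k | c k \<noteq> 0. c k * delta (wconj g k w) x)"
    by (simp add: fun_eq_iff chain_fun_lact[OF assms(1)])
  have c: "finite {k. c k \<noteq> 0}" using assms(1) by (simp add: laurent_def)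
  have fk: "finite {x. c k * delta (wconj g k w) x \<noteq> 0}" for k
    by (rule finite_subset[OF _ finite_delta[of "wconj g k w"]]) auto
  show "finite {x. chain_fun (lact g c [(1, w)]) x \<noteq> 0}"
    unfolding eq by (rule pairing_sum(1)[OF c fk])
  have fd: "finite {x. delta (wconj g k w) x \<noteq> (0::'k)}" for k by (rule finite_delta)
  have "pairing \<delta> (chain_fun (lact g c [(1, w)]))
      = (\<Sum>k | c k \<noteq> 0. Poly_Mapping.single 0 (c k) * (T k * fox \<delta> w))"
    unfolding eq pairing_sum(2)[OF c fk] pairing_scale[OF fd] pairing_delta fox_wconj[OF assms(2)] ..
  also have "\<dots> = (\<Sum>k | c k \<noteq> 0. Poly_Mapping.single k (c k)) * fox \<delta> w"
    by (simp add: sum_distrib_right mult.assoc[symmetric] mult_single)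
  also have "(\<Sum>k | c k \<noteq> 0. Poly_Mapping.single k (c k)) = Abs_poly_mapping c"
    using poly_mapping_sum_single[of "Abs_poly_mapping c"] c by (simp add: keys.rep_eq)
  finally show "pairing \<delta> (chain_fun (lact g c [(1, w)])) = Abs_poly_mapping c * fox \<delta> w" .
qed

subsection \<open>Components of the reduced graph\<close>

lemma VR_iff: "v \<in> VR V m \<longleftrightarrow> v \<in> V \<and> mu v = 0"
  using m_mu d by (auto simp: VR_def)

lemma V1_iff: "v \<in> V1 V E m \<longleftrightarrow> v \<in> V \<and> (mu v = 0 \<longrightarrow> (\<forall>w. {v, w} \<in> E \<longrightarrow> mu w = 0))"
  using edge_in by (auto simp: V1_def VR_iff)

text \<open>An edge with exactly one resonant endpoint disappears together with that endpoint, so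
  both endpoints of a surviving edge are non-resonant.\<close>

lemma E1_iff: "{v, w} \<in> E1 V E lt m K \<longleftrightarrow> {v, w} \<in> E \<and> mu v \<noteq> 0 \<and> mu w \<noteq> 0 \<and> {v, w} \<notin> ER E lt m K"
  using edge_in[of v w] by (auto simp: E1_def VR_iff V1_iff insert_commute)

abbreviation conn :: "'v rel" where
  "conn \<equiv> {(v, w). {v, w} \<in> E1 V E lt m K}\<^sup>*"

abbreviation comps :: "'v set set" where
  "comps \<equiv> components1 V E lt m K"

lemma equiv_conn: "equiv (V1 V E m) (conn \<inter> V1 V E m \<times> V1 V E m)"
proof (rule equivI)
  have "sym {(v, w). {v, w} \<in> E1 V E lt m K}" by (auto simp: sym_def insert_commute)
  then have "sym conn" by (rule sym_rtrancl)
  then show "sym (conn \<inter> V1 V E m \<times> V1 V E m)" by (auto simp: sym_def)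
  show "trans (conn \<inter> V1 V E m \<times> V1 V E m)"
    by (rule transI) (auto intro: rtrancl_trans)
qed (auto simp: refl_on_def)

lemma comps_conn: "C \<in> comps \<Longrightarrow> v \<in> C \<Longrightarrow> w \<in> C \<Longrightarrow> (v, w) \<in> conn"
  using quotient_eq_iff[OF equiv_conn] unfolding components1_def by blast

lemma comps_closed:
  assumes "C \<in> comps" "v \<in> C" "{v, w} \<in> E1 V E lt m K" shows "w \<in> C"
proof -
  have v: "v \<in> V1 V E m" using assms in_quotient_imp_subset[OF equiv_conn] by (auto simp: components1_def)
  moreover have "w \<in> V1 V E m" using assms(3) by (auto simp: E1_def)
  ultimately have "(v, w) \<in> conn \<inter> V1 V E m \<times> V1 V E m" using assms(3) by auto
  then show ?thesis
    using assms in_quotient_imp_closed[OF equiv_conn] by (auto simp: components1_def)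
qed

lemma comps_disjoint: "C \<in> comps \<Longrightarrow> C' \<in> comps \<Longrightarrow> v \<in> C \<Longrightarrow> v \<in> C' \<Longrightarrow> C = C'"
  using quotient_disj[OF equiv_conn] unfolding components1_def by blast

lemma comps_Union: "\<Union>comps = V1 V E m"
  unfolding components1_def by (rule Union_quotient[OF equiv_conn])

lemma comps_nonempty: "C \<in> comps \<Longrightarrow> \<exists>v. v \<in> C"
  using in_quotient_imp_non_empty[OF equiv_conn] unfolding components1_def by blast

lemma finite_comps: "finite comps"
proof -
  have "finite (V1 V E m)" using fin by (simp add: V1_def)
  then show ?thesis using comps_Union by (metis finite_UnionD)
qed

text \<open>A solution of the edge equations supported on one component. The value 1 concerns
  isolated resonant vertices, where \<open>1 - T (mu v)\<close> would vanish.\<close>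

definition comp_weight :: "'v set \<Rightarrow> 'v \<Rightarrow> (int \<Rightarrow>\<^sub>0 'k)" where
  "comp_weight C v = (if v \<in> C then if mu v = 0 then 1 else 1 - T (mu v) else 0)"

text \<open>A resonant endpoint in \<open>C\<close> has only resonant neighbours, which kills its
  coefficient; a resonant edge has \<open>gsum\<close> zero; any other edge between non-resonant
  vertices has both ends in \<open>C\<close> or neither, and the two products cancel.\<close>

lemma compatible_comp_weight:
  assumes C: "C \<in> comps" shows "compatible (comp_weight C)"
  unfolding compatible_def
proof (intro allI impI)
  fix v w assume e: "{v, w} \<in> E"
  have CV: "x \<in> V1 V E m" if "x \<in> C" for x using C that comps_Union by blast
  show "gsum v w * ((1 - T (mu w)) * comp_weight C v - (1 - T (mu v)) * comp_weight C w) = 0"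
  proof (cases "mu v = 0 \<or> mu w = 0")
    case True
    have "mu w = 0" if "v \<in> C" "mu v = 0" using CV[OF that(1)] that e by (auto simp: V1_iff)
    moreover have "mu v = 0" if "w \<in> C" "mu w = 0"
      using CV[OF that(1)] that e by (auto simp: V1_iff insert_commute)
    ultimately show ?thesis using True by (auto simp: comp_weight_def)
  next
    case False
    show ?thesis
    proof (cases "{v, w} \<in> ER E lt m K")
      case True
      then show ?thesis using gsum_eq_0_iff[OF e] by simp
    next
      case nER: False
      then have "{v, w} \<in> E1 V E lt m K" using e False by (simp add: E1_iff)
      then have "v \<in> C \<longleftrightarrow> w \<in> C"
        using comps_closed[OF C] by (metis insert_commute)
      then show ?thesis using False by (simp add: comp_weight_def mult.commute)
    qed
  qed
qed

end

section \<open>Lower bound: independent commutators, one for each component other than that of the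
  base vertex\<close>

context artin_char_base
begin

definition base_comp :: "'v set" where
  "base_comp = (THE C. C \<in> comps \<and> v0 \<in> C)"

lemma base_comp: "base_comp \<in> comps" "v0 \<in> base_comp"
proof -
  have "v0 \<in> \<Union>comps" using v0 by (simp add: comps_Union V1_iff)
  then have "\<exists>!C. C \<in> comps \<and> v0 \<in> C" using comps_disjoint by blast
  from theI'[OF this] show "base_comp \<in> comps" "v0 \<in> base_comp" by (auto simp: base_comp_def)
qed

text \<open>Representing its component by \<open>v0\<close> gives that component the class 0 by
  \<open>ccls_v0\<close>; this is the source of the minus one in the rank.\<close>

definition rep :: "'v set \<Rightarrow> 'v" where
  "rep C = (if C = base_comp then v0 else SOME v. v \<in> C)"

lemma rep_in: "C \<in> comps \<Longrightarrow> rep C \<in> C"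
  using comps_nonempty[of C] base_comp by (auto simp: rep_def intro: someI_ex)

lemma rep_V: "C \<in> comps \<Longrightarrow> rep C \<in> V"
  using rep_in comps_Union by (fastforce simp: V1_iff)

text \<open>The letters of \<open>v0\<close> contribute nothing; g_v contributes the value shifted
  by \<open>T (mu v0)\<close>, and its inverse contributes the value unshifted with a minus
  sign.\<close>

lemma fox_comm:
  assumes "\<delta> v0 = 0"
  shows "fox \<delta> (comm [(v, True)]) = (T (mu v0) - 1) * \<delta> v"
proof -
  have "T (mu v0) * (T (mu v) * (T (- mu v0) * (T (- mu v) * \<delta> v))) = \<delta> v"
    by (simp add: mult.left_commute[of "T (mu v)"])
  then show ?thesis
    using assms by (simp add: comm_def right_diff_distrib left_diff_distrib del: mult_cancel_right2)
qed

text \<open>Evaluating the weights of the components on the commutators of their representatives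
  gives a diagonal matrix with nonzero diagonal, so a null combination has zero
  coefficients.\<close>

lemma exists_indep:
  "\<exists>xs :: ('k \<times> 'v word) list list. length xs = card comps - 1 \<and> h1_indep V E lt m g xs"
proof -
  have "finite (comps - {base_comp})" using finite_comps by simp
  then obtain Cs where Cs: "set Cs = comps - {base_comp}" "distinct Cs"
    using finite_distinct_list[of "comps - {base_comp}"] by auto
  have "length Cs = card (comps - {base_comp})"
    using distinct_card[OF Cs(2)] unfolding Cs(1) by (rule sym)
  also have "\<dots> = card comps - 1" by (rule card_Diff_singleton[OF base_comp(1)])
  finally have len: "length Cs = card comps - 1" .
  define w where "w C = comm [(rep C, True)]" for C
  define xs where "xs = map (\<lambda>C. [(1::'k, w C)]) Cs"
  have wK: "w C \<in> akernel V m" if "C \<in> set Cs" for C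
  proof -
    have "rep C \<in> V" using that Cs(1) by (intro rep_V) simp
    then show ?thesis unfolding w_def by (intro comm_akernel) simp
  qed
  have "h1_indep V E lt m g xs"
    unfolding h1_indep_def
  proof (intro conjI allI impI)
    show "\<forall>x\<in>set xs. valid_chain V m x"
      unfolding xs_def valid_chain_def using wK by simp
    fix cs :: "(int \<Rightarrow> 'k) list"
    assume l: "length cs = length xs" and lau: "\<forall>c\<in>set cs. laurent c"
      and n: "null (chain_fun (concat (map2 (lact g) cs xs)))"
    let ?n = "length Cs"
    have lx: "length xs = ?n" by (simp add: xs_def)
    have eq: "chain_fun (concat (map2 (lact g) cs xs)) = (\<lambda>x. \<Sum>i<?n. chain_fun (lact g (cs ! i) [(1, w (Cs ! i))]) x)"
    proof
      fix x
      have "xs ! i = [(1, w (Cs ! i))]" if "i < ?n" for i using that by (simp add: xs_def)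
      then show "chain_fun (concat (map2 (lact g) cs xs)) x
          = (\<Sum>i<?n. chain_fun (lact g (cs ! i) [(1, w (Cs ! i))]) x)"
        unfolding chain_fun_concat_map2[OF l] lx by (intro sum.cong) simp_all
    qed
    have L: "laurent (cs ! i)" if "i < ?n" for i using lau l lx that by simp
    have W: "w (Cs ! i) \<in> akernel V m" if "i < ?n" for i using wK that by simp
    have sum0: "(\<Sum>i<?n. Abs_poly_mapping (cs ! i) * fox \<delta> (w (Cs ! i))) = 0" if "compatible \<delta>" for \<delta>
    proof -
      have "(\<Sum>i<?n. Abs_poly_mapping (cs ! i) * fox \<delta> (w (Cs ! i)))
          = (\<Sum>i<?n. pairing \<delta> (chain_fun (lact g (cs ! i) [(1, w (Cs ! i))])))"
        by (rule sum.cong) (simp_all add: pairing_lact(2) L W)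
      also have "\<dots> = pairing \<delta> (chain_fun (concat (map2 (lact g) cs xs)))"
        unfolding eq by (rule pairing_sum(2)[symmetric]) (simp_all add: pairing_lact(1) L W)
      also have "\<dots> = 0"
        using pairing_null[OF that n] by (rule conjunct2)
      finally show ?thesis .
    qed
    have zero: "cs ! j = (\<lambda>_. 0)" if j: "j < ?n" for j
    proof -
      let ?C = "Cs ! j"
      have C: "?C \<in> comps" "?C \<noteq> base_comp" using Cs j nth_mem by blast+
      \<comment> \<open>The component differs from that of \<open>v0\<close>, so its weight vanishes
        at \<open>v0\<close>, as \<open>fox_comm\<close> demands.\<close>
      have v0C: "v0 \<notin> ?C" using comps_disjoint[OF C(1) base_comp(1) _ base_comp(2)] C by blast
      let ?\<delta> = "comp_weight ?C"
      have fw: "fox ?\<delta> (w C) = (T (mu v0) - 1) * ?\<delta> (rep C)" for C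
        unfolding w_def by (rule fox_comm) (simp add: comp_weight_def v0C)
      have "fox ?\<delta> (w (Cs ! i)) = 0" if i: "i < ?n" "i \<noteq> j" for i
      proof -
        have Ci: "Cs ! i \<in> comps" using Cs i nth_mem by blast
        have "Cs ! i \<noteq> ?C" using Cs(2) i j by (simp add: nth_eq_iff_index_eq)
        then have "rep (Cs ! i) \<notin> ?C" using comps_disjoint[OF Ci C(1) rep_in[OF Ci]] by blast
        then show ?thesis by (simp add: fw comp_weight_def)
      qed
      then have "(\<Sum>i<?n. Abs_poly_mapping (cs ! i) * fox ?\<delta> (w (Cs ! i)))
          = Abs_poly_mapping (cs ! j) * fox ?\<delta> (w (Cs ! j))"
        using j by (subst sum.remove[of "{..<?n}" j]) simp_all
      then have "Abs_poly_mapping (cs ! j) * fox ?\<delta> (w ?C) = 0"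
        using sum0[OF compatible_comp_weight[OF C(1)]] by simp
      moreover have "fox ?\<delta> (w ?C) \<noteq> 0"
      proof -
        have "?\<delta> (rep ?C) \<noteq> 0" using rep_in[OF C(1)] T_ne_1 by (simp add: comp_weight_def)
        moreover have "T (mu v0) - 1 \<noteq> 0" using T_ne_1[OF v0(2)] by simp
        ultimately show ?thesis by (simp add: fw)
      qed
      ultimately have A: "Abs_poly_mapping (cs ! j) = 0" by simp
      have "Poly_Mapping.lookup (Abs_poly_mapping (cs ! j)) = cs ! j"
        using L[OF j] by (simp add: laurent_def)
      from this[symmetric] show ?thesis unfolding A by (simp add: fun_eq_iff)
    qed
    show "\<forall>c\<in>set cs. \<forall>k. c k = 0"
      using zero l lx by (auto simp: in_set_conv_nth)
  qed
  then show ?thesis using len by (auto simp: xs_def intro!: exI[of _ xs])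
qed

section \<open>Upper bound: representatives of the components generate up to torsion\<close>

text \<open>A deleted vertex has a torsion class through an edge to a non-resonant neighbour. A
  remaining vertex is reached from its representative along a path in \<Gamma>_1, one application of
  \<open>ccls_edge_sat\<close> for each edge.\<close>

lemma ccls_generators_sat:
  assumes v: "v \<in> V"
  shows "ccls [(v, True)] \<in> sat ((\<lambda>C. ccls [(rep C, True)]) ` (comps - {base_comp}))"
    (is "_ \<in> sat ?X")
proof (cases "v \<in> V1 V E m")
  case False
  then obtain w where w: "mu v = 0" "{v, w} \<in> E" "mu w \<noteq> 0" using v by (auto simp: V1_iff)
  have vw: "v \<in> V" "w \<in> V" "v \<noteq> w" using edge_in[OF w(2)] by auto
  have "{v, w} \<notin> ER E lt m K"
    using w vw d by (auto simp: ER_def m_mu)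
  then show ?thesis using w by (intro ccls_edge_sat) auto
next
  case True
  then obtain C where C: "C \<in> comps" "v \<in> C" using comps_Union by blast
  have rep: "ccls [(rep C, True)] \<in> sat ?X"
  proof (cases "C = base_comp")
    case True
    then show ?thesis
      using sat_eqv[OF ccls_v0 pm.subspace_0[OF subspace_sat]] by (simp add: rep_def)
  next
    case False
    then show ?thesis using C by (intro span_sat pm.span_base) auto
  qed
  have "(rep C, v) \<in> conn" by (rule comps_conn[OF C(1) rep_in[OF C(1)] C(2)])
  then show ?thesis
  proof (induction rule: rtrancl_induct)
    case base
    show ?case by (rule rep)
  next
    case (step y z)
    then have "{z, y} \<in> E1 V E lt m K" by (simp add: insert_commute)
    then show ?case using step by (intro ccls_edge_sat[of z y]) (auto simp: E1_iff)
  qed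
qed

text \<open>A longer family would be dependent modulo \<open>rels\<close>, and
  \<open>realize\<close> turns this dependence into a null chain with the same nonzero
  coefficients.\<close>

lemma indep_length:
  fixes xs :: "('k \<times> 'v word) list list"
  assumes "h1_indep V E lt m g xs" shows "length xs \<le> card comps - 1"
proof (rule ccontr)
  assume less: "\<not> length xs \<le> card comps - 1"
  let ?X = "(\<lambda>C. ccls [(rep C, True)]) ` (comps - {base_comp})"
  have fX: "finite ?X" using finite_comps by simp
  have "card ?X \<le> card (comps - {base_comp})" using finite_comps by (intro card_image_le) simp
  also have "\<dots> = card comps - 1" by (rule card_Diff_singleton[OF base_comp(1)])
  finally have cX: "card ?X < length xs" using less by linarith
  have "chain_elem (xs ! i) \<in> sat ?X" if "i < length xs" for i
  proof (rule all_sat[OF ccls_generators_sat])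
    have "valid_chain V m (xs ! i)" using assms that by (simp add: h1_indep_def)
    then show "Poly_Mapping.keys (chain_elem (xs ! i)) \<subseteq> akernel V m"
      using keys_chain_elem[of "xs ! i"] by (auto simp: valid_chain_def)
  qed
  then obtain c
    where c: "\<exists>i<length xs. c i \<noteq> 0" "(\<Sum>i<length xs. pscale (c i) (chain_elem (xs ! i))) \<in> rels"
    by (rule sat_dependence[OF fX cX])
  define cs where "cs = map (\<lambda>i. Poly_Mapping.lookup (c i)) [0..<length xs]"
  have l: "length cs = length xs" by (simp add: cs_def)
  have lau: "laurent (Poly_Mapping.lookup p)" for p :: "int \<Rightarrow>\<^sub>0 'k"
    by (simp add: laurent_def)
  have "chain_fun (concat (map2 (lact g) cs xs)) = realize g (\<Sum>i<length xs. pscale (c i) (chain_elem (xs ! i)))"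
  proof
    fix x
    have "realize g (pscale (c i) (chain_elem (xs ! i))) x
        = chain_fun (lact g (Poly_Mapping.lookup (c i)) (xs ! i)) x" for i
      using realize_chain_elem[OF lau[of "c i"], of g "xs ! i" x] unfolding lookup_inverse .
    then show "chain_fun (concat (map2 (lact g) cs xs)) x
        = realize g (\<Sum>i<length xs. pscale (c i) (chain_elem (xs ! i))) x"
      unfolding chain_fun_concat_map2[OF l] realize_sum by (intro sum.cong) (simp_all add: cs_def)
  qed
  then have "null (chain_fun (concat (map2 (lact g) cs xs)))"
    using realize_rels[OF c(2)] by (simp only:)
  moreover have "\<forall>c\<in>set cs. laurent c" using lau by (simp add: cs_def)
  ultimately have "\<forall>c\<in>set cs. \<forall>k. c k = 0"
    using assms l unfolding h1_indep_def by blast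
  then have "c i = 0" if "i < length xs" for i
    using that by (intro poly_mapping_eqI) (auto simp: cs_def)
  then show False using c(1) by blast
qed

section \<open>Rank and torsion\<close>

lemma free_rank: "h1_free_rank_is V E lt m g K (dim_rH0_Gamma1 V E lt m K)"
  unfolding h1_free_rank_is_def dim_rH0_Gamma1_def
  using exists_indep indep_length by blast

lemma torsion_iff: "h1_torsion V E lt m g K \<longleftrightarrow> connected1 V E lt m K"
proof
  assume tor: "h1_torsion V E lt m g K"
  obtain xs :: "('k \<times> 'v word) list list"
    where xs: "length xs = card comps - 1" "h1_indep V E lt m g xs" using exists_indep by blast
  have "xs = []"
  proof (rule ccontr)
    assume "xs \<noteq> []"
    then obtain x ys where x: "xs = x # ys" by (cases xs) auto
    then have "valid_chain V m x" using xs by (simp add: h1_indep_def)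
    then obtain c where c: "laurent c" "\<exists>k. c k \<noteq> 0" "null (chain_fun (lact g c x))"
      using tor unfolding h1_torsion_def by blast
    \<comment> \<open>An annihilator of the first member, padded with zeros, would be a nontrivial
      relation of the independent family.\<close>
    let ?cs = "c # replicate (length ys) (\<lambda>_. 0)"
    have "lact g (\<lambda>_. 0 :: 'k) y = []" for y by (simp add: lact_def)
    then have "concat (map2 (lact g) (replicate (length ys) (\<lambda>_. 0)) ys) = []"
      by (induction ys) auto
    then have "concat (map2 (lact g) ?cs xs) = lact g c x"
      by (simp only: x zip_Cons_Cons list.map prod.case concat.simps append_Nil2)
    then have "null (chain_fun (concat (map2 (lact g) ?cs xs)))" using c(3) by (simp only:)
    moreover have "\<forall>c\<in>set ?cs. laurent c" using c by (auto simp: laurent_def)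
    ultimately have "\<forall>c\<in>set ?cs. \<forall>k. c k = 0"
      using xs(2) x unfolding h1_indep_def by (metis length_Cons length_replicate)
    then show False using c(2) by auto
  qed
  \<comment> \<open>Subtraction is truncated, so \<open>card comps - 1 = 0\<close> gives one
    component only because the component of \<open>v0\<close> exists.\<close>
  moreover have "card comps > 0" using base_comp(1) finite_comps card_gt_0_iff by blast
  ultimately show "connected1 V E lt m K" using xs(1) by (simp add: connected1_def)
next
  assume "connected1 V E lt m K"
  then have card: "card comps - 1 = 0" by (simp add: connected1_def)
  show "h1_torsion V E lt m g K"
    unfolding h1_torsion_def
  proof (intro allI impI)
    fix x :: "('k \<times> 'v word) list" assume x: "valid_chain V m x"
    have "\<not> h1_indep V E lt m g [x]" using indep_length[of "[x]"] card by auto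
    then obtain cs where cs: "length cs = length [x]" "\<forall>c\<in>set cs. laurent c"
      "null (chain_fun (concat (map2 (lact g) cs [x])))" "\<not> (\<forall>c\<in>set cs. \<forall>k. c k = 0)"
      using x unfolding h1_indep_def by auto
    then obtain c where "cs = [c]" by (cases cs) auto
    then show "\<exists>c. laurent c \<and> (\<exists>k. c k \<noteq> 0) \<and> null (chain_fun (lact g c x))"
      using cs by auto
  qed
qed

end

section \<open>Normalising the character by a generator of its image\<close>

theorem theorem4p1:
  fixes V :: "'v set" and E :: "'v set set" and lt :: "'v set \<Rightarrow> nat"
    and m :: "'v \<Rightarrow> int" and g :: "'v word" and K :: "'k::field itself"
  assumes "finite V"
    and "\<forall>e \<in> E. \<exists>v w. v \<in> V \<and> w \<in> V \<and> v \<noteq> w \<and> e = {v, w}"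
    and "\<forall>e \<in> E. 1 \<le> lt e"
    and "\<exists>v \<in> V. m v \<noteq> 0"
    and "g \<in> words V"
    and "chi m ` words V = range (\<lambda>k. k * chi m g)"
  shows "h1_free_rank_is V E lt m g K (dim_rH0_Gamma1 V E lt m K)
    \<and> (h1_torsion V E lt m g K \<longleftrightarrow> connected1 V E lt m K)"
proof -
  define d where "d = chi m g"
  define mu where "mu v = m v div d" for v
  obtain v0 where v0: "v0 \<in> V" "m v0 \<noteq> 0" using assms(4) by blast
  have dvd: "m v = d * mu v" if "v \<in> V" for v
  proof -
    have "chi m [(v, True)] \<in> chi m ` words V" using that by (intro imageI) simp
    then show ?thesis using assms(6) by (auto simp: mu_def d_def)
  qed
  \<comment> \<open>Either value being zero would force \<open>m v0 = 0\<close>.\<close>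
  then have d: "d \<noteq> 0" and mu0: "mu v0 \<noteq> 0" using v0 by fastforce+
  have "d = d * chi mu g" unfolding d_def using chi_scale[of V m d mu g] dvd assms(5) by (simp add: d_def)
  then have mu_g: "chi mu g = 1" using d by simp
  interpret artin_char_base V E lt m mu g d K v0
    by unfold_locales (use assms d dvd mu_g v0 mu0 in auto)
  show ?thesis using free_rank torsion_iff by blast
qed

end
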